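(* Let $P$ follow a semiparametric GLM DAG on a DAG $G=(V,E)$, under the regularity and moment conditions stated in the context. (i) If $P$ follows a nonlinear semiparametric GLM DAG on $G$, then for every nonempty ancestral set $R\subseteq V$ and every $j\in R$: $j$ is a sink of the induced subgraph $G_R$ if and only if $S_j(R)=0$. (ii) Given any causal order $\pi$ of $G$, any node $i$ and any $j\in\mathrm{Pred}(i)$: $j\in\operatorname{Pa}_G(i)$ if and only if $\mathrm{OCS}_{j\to i}>0$.
   Context: Graph notation. $G=(V,E)$ is a DAG with $V=\{1,\dots,d\}$; $\operatorname{Pa}_G(j)$ and $\operatorname{Ch}_G(j)$ are the parents and children of $j$. A source has no parents; a sink has no children. $G_R$ is the induced subgraph on $R\subseteq V$. A set $R$ is ancestral if it is obtained from $V$ by repeatedly removing a sink of the current induced subgraph (equivalently, $R$ contains the parents of all its elements). A causal order is a bijection $\pi:V\to\{1,\dots,d\}$ with $\pi(j)<\pi(i)$ for every edge $j\to i$; $\mathrm{Pred}(i)=\{j:\pi(j)<\pi(i)\}$ and $R_i=\{i\}\cup\mathrm{Pred}(i)$. Variables. $X=(X_1,\dots,X_d)$ has law $P$. Each $X_j$ is continuous (support $\mathcal X_j\subseteq\mathbb R$ a connected interval with nonempty interior, $\nu_j$ Lebesgue measure, $\mathring{\mathcal X}_j=\operatorname{int}\mathcal X_j$) or count (support $\mathcal X_j$ a set of consecutive integers, bounded below, with at least three elements, $\nu_j$ counting measure, $\mathring{\mathcal X}_j=\mathcal X_j$). $p$ is the density of $P$ with respect to $\bigotimes_j\nu_j$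 (densities include mass functions). For $A\subseteq V$, $X_A=(X_i)_{i\in A}$, $\mathring{\mathcal X}_A=\prod_{i\in A}\mathring{\mathcal X}_i$; $P_R$ and $p_R$ are the law and density of $X_R$. Semiparametric GLM DAG. $P$ follows a semiparametric GLM DAG on $G$ if $p(x)=\prod_jp_j(x_j\mid x_{\operatorname{Pa}_G(j)})$, where source marginal densities $p_j$ on $\mathcal X_j$ are arbitrary, and for every non-source $j$ $$p_j(x_j\mid x_{\operatorname{Pa}_G(j)})=b_j(x_j)\exp\{x_j\eta_j(x_{\operatorname{Pa}_G(j)})-A_j(\eta_j(x_{\operatorname{Pa}_G(j)}))\},\quad A_j(t)=\log\int_{\mathcal X_j}b_j(u)e^{ut}\,d\nu_j(u),$$ where $\mathcal X_j$ and $b_j$ do not depend on the parent values, and $\eta_j$ depends nontrivially (is nonconstant) in every parent coordinate on $\mathring{\mathcal X}_{\operatorname{Pa}_G(j)}$. It is nonlinear if for every edge $k\to i$ there are fixed values $z$ of the other parents of $i$ in the interior of their product support such that $\eta_i(\cdot,z)$ is not affine on $\mathring{\mathcal X}_k$. Regularity. Densities are finite and strictly positive on product-support interiors. Source densities and base functions $b_j$ are finite and strictly positive on support interiors with logarithms $C^2$ in continuous coordinates. Each $\eta_j$ is finite and jointly $C^2$ in its continuous parent coordinates for each fixed choice of the count parents. Required finite differences are finite on their admissible domains. $\eta_j(\mathring{\mathcal X}_{\operatorname{Pa}_G(j)})\subseteq\operatorname{int}\{t\in\mathbb R:A_j(t)<\infty\}$. Operators. For continuous $X_j$: $\mathcal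 D_jf=\partial_{x_j}f$, $\mathcal D_j^2f=\partial_{x_j}^2f$. For count $X_j$: $\mathcal D_jf(x)=f(x+e_j)-f(x)$, $\mathcal D_j^2f(x)=f(x+2e_j)-2f(x+e_j)+f(x)$, defined only where all shifted values stay in the support. For $r\in\{1,2\}$, let $\mathcal X_j^{\circ,r}=\{x_j:x_j,x_j+1,\dots,x_j+r\in\mathcal X_j\}$ for count $X_j$ and $\mathcal X_j^{\circ,r}=\mathring{\mathcal X}_j$ for continuous $X_j$. Admissible events: $\mathcal A_j^{(2)}=\{X_j\in\mathcal X_j^{\circ,2}\}$, and for $i\ne j$, $\mathcal A_{ij}^{(1,1)}=\{X_i\in\mathcal X_i^{\circ,1},X_j\in\mathcal X_j^{\circ,1}\}$. Curvatures and scores. $H_{j,R}=\mathcal D_j^2\log p_R$ and $H_{ij,R}=\mathcal D_i\mathcal D_j\log p_R$ ($i\ne j$). The conditional curvature score is $$S_j(R)=\mathbb E[\operatorname{Var}\{H_{j,R}(X_R)\mid X_j\}],$$ with expectation and conditional variance under $P_R(\,\cdot\mid\mathcal A_j^{(2)})$. The off-diagonal curvature score is $$\mathrm{OCS}_{j\to i}=\mathbb E\bigl[|H_{ij,R_i}(X_{R_i})|\bigr],$$ with expectation under $P_{R_i}(\,\cdot\mid\mathcal A_{ij}^{(1,1)})$. Moment conditions. For (i): $H_{j,R}\in L^2(P_R(\cdot\mid\mathcal A_j^{(2)}))$ for every nonempty ancestral $R$ and $j\in R$. For (ii): $H_{ij,R_i}\in L^1(P_{R_i}(\cdot\mid\mathcal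 A_{ij}^{(1,1)}))$ for every $i$ and $j\in\mathrm{Pred}(i)$. *)

theory Defs
  imports "HOL-Probability.Probability"
begin

section \<open>Directed acyclic graphs on \<open>{1..d}\<close>\<close>

text \<open>A graph is given by its edge set; \<open>(j, i) \<in> E\<close> is the edge from \<open>j\<close> to \<open>i\<close>.\<close>

definition Pa :: "(nat \<times> nat) set \<Rightarrow> nat \<Rightarrow> nat set" where
  "Pa E j = {k. (k, j) \<in> E}"

definition Ch :: "(nat \<times> nat) set \<Rightarrow> nat \<Rightarrow> nat set" where
  "Ch E j = {k. (j, k) \<in> E}"

definition is_dag :: "nat \<Rightarrow> (nat \<times> nat) set \<Rightarrow> bool" where
  "is_dag d E \<longleftrightarrow> E \<subseteq> {1..d} \<times> {1..d} \<and> acyclic E"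

definition induced :: "(nat \<times> nat) set \<Rightarrow> nat set \<Rightarrow> (nat \<times> nat) set" where
  "induced E R = E \<inter> R \<times> R"

definition is_sink :: "(nat \<times> nat) set \<Rightarrow> nat set \<Rightarrow> nat \<Rightarrow> bool" where
  "is_sink E R j \<longleftrightarrow> j \<in> R \<and> Ch (induced E R) j = {}"

inductive ancestral :: "nat \<Rightarrow> (nat \<times> nat) set \<Rightarrow> nat set \<Rightarrow> bool" for d E where
  full: "ancestral d E {1..d}"
| remove_sink: "ancestral d E R \<Longrightarrow> is_sink E R j \<Longrightarrow> ancestral d E (R - {j})"

definition causal_order :: "nat \<Rightarrow> (nat \<times> nat) set \<Rightarrow> (nat \<Rightarrow> nat) \<Rightarrow> bool" where
  "causal_order d E \<pi> \<longleftrightarrow> bij_betw \<pi> {1..d} {1..d} \<and> (\<forall>(j, i)\<in>E. \<pi> j < \<pi> i)"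

definition Pred :: "nat \<Rightarrow> (nat \<Rightarrow> nat) \<Rightarrow> nat \<Rightarrow> nat set" where
  "Pred d \<pi> i = {j \<in> {1..d}. \<pi> j < \<pi> i}"

section \<open>Continuous and count variables\<close>

text \<open>Throughout, \<open>C\<close> is the set of indices of count variables (all other indices are continuous),
  \<open>X j\<close> is the support of the \<open>j\<close>-th variable, count values being embedded in the reals, and a
  point of a product of supports indexed by \<open>R\<close> is a function in \<open>Pi\<^sub>E R X\<close>.\<close>

definition continuous_support :: "real set \<Rightarrow> bool" where
  "continuous_support S \<longleftrightarrow> is_interval S \<and> interior S \<noteq> {}"

definition count_support :: "real set \<Rightarrow> bool" where
  "count_support S \<longleftrightarrow> S \<subseteq> \<int> \<and> (\<forall>a\<in>S. \<forall>c\<in>S. \<forall>u\<in>\<int>. a \<le> u \<and> u \<le> c \<longrightarrow> u \<in> S)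
     \<and> bdd_below S \<and> (infinite S \<or> 3 \<le> card S)"

text \<open>The reference measures live on the supports themselves, so densities and base functions are
  functions on the supports and their values elsewhere are irrelevant.\<close>

definition ref_measure :: "nat set \<Rightarrow> (nat \<Rightarrow> real set) \<Rightarrow> nat \<Rightarrow> real measure" where
  "ref_measure C X j = (if j \<in> C then count_space (X j) else restrict_space lborel (X j))"

definition supp_int :: "nat set \<Rightarrow> (nat \<Rightarrow> real set) \<Rightarrow> nat \<Rightarrow> real set" where
  "supp_int C X j = (if j \<in> C then X j else interior (X j))"

definition prod_int :: "nat set \<Rightarrow> (nat \<Rightarrow> real set) \<Rightarrow> nat set \<Rightarrow> (nat \<Rightarrow> real) set" where
  "prod_int C X A = Pi\<^sub>E A (supp_int C X)"

definition adm :: "nat set \<Rightarrow> (nat \<Rightarrow> real set) \<Rightarrow> nat \<Rightarrow> nat \<Rightarrow> real set" where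
  "adm C X r j = (if j \<in> C then {u. \<forall>s\<le>r. u + real s \<in> X j} else interior (X j))"

section \<open>Derivatives and finite differences\<close>

definition partial :: "nat \<Rightarrow> ((nat \<Rightarrow> real) \<Rightarrow> real) \<Rightarrow> (nat \<Rightarrow> real) \<Rightarrow> real" where
  "partial k f x = deriv (\<lambda>t. f (x(k := t))) (x k)"

definition has_partial_on :: "nat \<Rightarrow> ((nat \<Rightarrow> real) \<Rightarrow> real) \<Rightarrow> (nat \<Rightarrow> real) set \<Rightarrow> bool" where
  "has_partial_on k f U \<longleftrightarrow> (\<forall>x\<in>U. (\<lambda>t. f (x(k := t))) differentiable at (x k))"

text \<open>Joint \<open>C\<^sup>2\<close> regularity in the coordinates \<open>K\<close>, on a set \<open>U\<close> that is a product of open intervals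
  in these coordinates and on which the other coordinates are constant.\<close>

definition C2_coords :: "nat set \<Rightarrow> ((nat \<Rightarrow> real) \<Rightarrow> real) \<Rightarrow> (nat \<Rightarrow> real) set \<Rightarrow> bool" where
  "C2_coords K f U \<longleftrightarrow> continuous_on U f
     \<and> (\<forall>k\<in>K. has_partial_on k f U \<and> continuous_on U (partial k f)
          \<and> (\<forall>l\<in>K. has_partial_on l (partial k f) U \<and> continuous_on U (partial l (partial k f))))"

definition C2_real :: "(real \<Rightarrow> real) \<Rightarrow> real set \<Rightarrow> bool" where
  "C2_real f U \<longleftrightarrow> (\<forall>x\<in>U. f differentiable at x \<and> deriv f differentiable at x)
     \<and> continuous_on U (deriv (deriv f))"

definition D1 :: "nat set \<Rightarrow> nat \<Rightarrow> ((nat \<Rightarrow> real) \<Rightarrow> real) \<Rightarrow> (nat \<Rightarrow> real) \<Rightarrow> real" where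
  "D1 C j f x = (if j \<in> C then f (x(j := x j + 1)) - f x else partial j f x)"

definition D2 :: "nat set \<Rightarrow> nat \<Rightarrow> ((nat \<Rightarrow> real) \<Rightarrow> real) \<Rightarrow> (nat \<Rightarrow> real) \<Rightarrow> real" where
  "D2 C j f x = (if j \<in> C then f (x(j := x j + 2)) - 2 * f (x(j := x j + 1)) + f x
                 else partial j (partial j f) x)"

section \<open>Semiparametric GLM DAGs\<close>

definition log_partition :: "real measure \<Rightarrow> (real \<Rightarrow> real) \<Rightarrow> real \<Rightarrow> real" where
  "log_partition \<nu> b t = ln (\<integral>u. b u * exp (u * t) \<partial>\<nu>)"

text \<open>The set where the log-partition function is finite; the integrands are almost everywhere
  positive, so finiteness of the integral is integrability.\<close>

definition natural_domain :: "real measure \<Rightarrow> (real \<Rightarrow> real) \<Rightarrow> real set" where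
  "natural_domain \<nu> b = {t. integrable \<nu> (\<lambda>u. b u * exp (u * t))}"

text \<open>\<open>q j\<close> is the marginal density of a source \<open>j\<close>; \<open>b j\<close> and \<open>\<eta> j\<close> are the base function and the
  natural-parameter function of a non-source \<open>j\<close>.\<close>

definition cond_dens ::
  "(nat \<times> nat) set \<Rightarrow> nat set \<Rightarrow> (nat \<Rightarrow> real set) \<Rightarrow> (nat \<Rightarrow> real \<Rightarrow> real) \<Rightarrow>
   (nat \<Rightarrow> real \<Rightarrow> real) \<Rightarrow> (nat \<Rightarrow> (nat \<Rightarrow> real) \<Rightarrow> real) \<Rightarrow> nat \<Rightarrow> (nat \<Rightarrow> real) \<Rightarrow> real" where
  "cond_dens E C X q b \<eta> j x =
     (if Pa E j = {} then q j (x j)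
      else b j (x j) * exp (x j * \<eta> j (restrict x (Pa E j))
             - log_partition (ref_measure C X j) (b j) (\<eta> j (restrict x (Pa E j)))))"

text \<open>A density is determined almost everywhere only. The version \<open>p\<close> to which the pointwise
  operators are applied is the one that factorizes at every point of the product-support interior,
  whose complement is a null set.\<close>

locale semiparametric_glm_dag =
  fixes d :: nat
    and E :: "(nat \<times> nat) set"
    and C :: "nat set"
    and X :: "nat \<Rightarrow> real set"
    and P :: "(nat \<Rightarrow> real) measure"
    and p :: "(nat \<Rightarrow> real) \<Rightarrow> real"
    and q :: "nat \<Rightarrow> real \<Rightarrow> real"
    and b :: "nat \<Rightarrow> real \<Rightarrow> real"
    and \<eta> :: "nat \<Rightarrow> (nat \<Rightarrow> real) \<Rightarrow> real"
  assumes dag: "is_dag d E"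
    and continuous_var: "\<And>j. j \<in> {1..d} - C \<Longrightarrow> continuous_support (X j)"
    and count_var: "\<And>j. j \<in> {1..d} \<inter> C \<Longrightarrow> count_support (X j)"
    and law_prob: "prob_space P"
    and p_measurable: "p \<in> borel_measurable (Pi\<^sub>M {1..d} (ref_measure C X))"
    and law_density: "P = density (Pi\<^sub>M {1..d} (ref_measure C X)) (\<lambda>x. ennreal (p x))"
    and source_density: "\<And>j. j \<in> {1..d} \<Longrightarrow> Pa E j = {} \<Longrightarrow>
          integrable (ref_measure C X j) (q j) \<and> (\<integral>u. q j u \<partial>ref_measure C X j) = 1"
    and factorization: "\<And>x. x \<in> prod_int C X {1..d} \<Longrightarrow>
          p x = (\<Prod>j\<in>{1..d}. cond_dens E C X q b \<eta> j x)"
    and eta_nontrivial: "\<And>k j. (k, j) \<in> E \<Longrightarrow>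
          \<exists>z\<in>prod_int C X (Pa E j). \<exists>t\<in>supp_int C X k. \<eta> j (z(k := t)) \<noteq> \<eta> j z"

definition nonlinear_glm ::
  "(nat \<times> nat) set \<Rightarrow> nat set \<Rightarrow> (nat \<Rightarrow> real set) \<Rightarrow> (nat \<Rightarrow> (nat \<Rightarrow> real) \<Rightarrow> real) \<Rightarrow> bool" where
  "nonlinear_glm E C X \<eta> \<longleftrightarrow> (\<forall>(k, i)\<in>E. \<exists>z\<in>prod_int C X (Pa E i - {k}).
     \<not> (\<exists>\<alpha> \<beta>. \<forall>t\<in>supp_int C X k. \<eta> i (z(k := t)) = \<alpha> * t + \<beta>))"

locale regular_glm_dag = semiparametric_glm_dag +
  assumes p_pos: "\<And>x. x \<in> prod_int C X {1..d} \<Longrightarrow> 0 < p x"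
    and q_pos: "\<And>j u. j \<in> {1..d} \<Longrightarrow> Pa E j = {} \<Longrightarrow> u \<in> supp_int C X j \<Longrightarrow> 0 < q j u"
    and q_C2: "\<And>j. j \<in> {1..d} - C \<Longrightarrow> Pa E j = {} \<Longrightarrow>
          C2_real (\<lambda>u. ln (q j u)) (interior (X j))"
    and b_pos: "\<And>j u. j \<in> {1..d} \<Longrightarrow> Pa E j \<noteq> {} \<Longrightarrow> u \<in> supp_int C X j \<Longrightarrow> 0 < b j u"
    and b_C2: "\<And>j. j \<in> {1..d} - C \<Longrightarrow> Pa E j \<noteq> {} \<Longrightarrow>
          C2_real (\<lambda>u. ln (b j u)) (interior (X j))"
    and eta_C2: "\<And>j c. j \<in> {1..d} \<Longrightarrow> Pa E j \<noteq> {} \<Longrightarrow>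
          C2_coords (Pa E j - C) (\<eta> j)
            {z \<in> prod_int C X (Pa E j). \<forall>k\<in>Pa E j \<inter> C. z k = c k}"
    and eta_range: "\<And>j. j \<in> {1..d} \<Longrightarrow> Pa E j \<noteq> {} \<Longrightarrow>
          \<eta> j ` prod_int C X (Pa E j) \<subseteq> interior (natural_domain (ref_measure C X j) (b j))"

section \<open>Marginals, curvatures and scores\<close>

definition marg_law ::
  "nat set \<Rightarrow> (nat \<Rightarrow> real set) \<Rightarrow> (nat \<Rightarrow> real) measure \<Rightarrow> nat set \<Rightarrow> (nat \<Rightarrow> real) measure" where
  "marg_law C X P R = distr P (Pi\<^sub>M R (ref_measure C X)) (\<lambda>x. restrict x R)"

definition marg_dens ::
  "nat \<Rightarrow> nat set \<Rightarrow> (nat \<Rightarrow> real set) \<Rightarrow> ((nat \<Rightarrow> real) \<Rightarrow> real) \<Rightarrow> nat set \<Rightarrow>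
   (nat \<Rightarrow> real) \<Rightarrow> real" where
  "marg_dens d C X p R x =
     (\<integral>y. p (merge R ({1..d} - R) (x, y)) \<partial>Pi\<^sub>M ({1..d} - R) (ref_measure C X))"

text \<open>The curvatures are set to 0 where they are not defined: off the product-support interior
  and where a shifted count value leaves the support. The first set is null and the second one
  is excluded by the admissible events.\<close>

definition curv ::
  "nat \<Rightarrow> nat set \<Rightarrow> (nat \<Rightarrow> real set) \<Rightarrow> ((nat \<Rightarrow> real) \<Rightarrow> real) \<Rightarrow> nat \<Rightarrow> nat set \<Rightarrow>
   (nat \<Rightarrow> real) \<Rightarrow> real" where
  "curv d C X p j R x =
     (if x \<in> prod_int C X R \<and> x j \<in> adm C X 2 j
      then D2 C j (\<lambda>y. ln (marg_dens d C X p R y)) x else 0)"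

definition mixed_curv ::
  "nat \<Rightarrow> nat set \<Rightarrow> (nat \<Rightarrow> real set) \<Rightarrow> ((nat \<Rightarrow> real) \<Rightarrow> real) \<Rightarrow> nat \<Rightarrow> nat \<Rightarrow> nat set \<Rightarrow>
   (nat \<Rightarrow> real) \<Rightarrow> real" where
  "mixed_curv d C X p i j R x =
     (if x \<in> prod_int C X R \<and> x i \<in> adm C X 1 i \<and> x j \<in> adm C X 1 j
      then D1 C i (D1 C j (\<lambda>y. ln (marg_dens d C X p R y))) x else 0)"

text \<open>\<^const>\<open>uniform_measure\<close> is the conditional law given an event.\<close>

definition adm_law ::
  "nat set \<Rightarrow> (nat \<Rightarrow> real set) \<Rightarrow> (nat \<Rightarrow> real) measure \<Rightarrow> nat \<Rightarrow> nat set \<Rightarrow>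
   (nat \<Rightarrow> real) measure" where
  "adm_law C X P j R = uniform_measure (marg_law C X P R)
     {x \<in> space (marg_law C X P R). x j \<in> adm C X 2 j}"

definition mixed_adm_law ::
  "nat set \<Rightarrow> (nat \<Rightarrow> real set) \<Rightarrow> (nat \<Rightarrow> real) measure \<Rightarrow> nat \<Rightarrow> nat \<Rightarrow> nat set \<Rightarrow>
   (nat \<Rightarrow> real) measure" where
  "mixed_adm_law C X P i j R = uniform_measure (marg_law C X P R)
     {x \<in> space (marg_law C X P R). x i \<in> adm C X 1 i \<and> x j \<in> adm C X 1 j}"

definition cond_variance ::
  "'a measure \<Rightarrow> ('a \<Rightarrow> real) \<Rightarrow> ('a \<Rightarrow> real) \<Rightarrow> 'a \<Rightarrow> real" where
  "cond_variance M Y f =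
     (let F = vimage_algebra (space M) Y borel
      in real_cond_exp M F (\<lambda>x. (f x - real_cond_exp M F f x)\<^sup>2))"

definition S_score ::
  "nat \<Rightarrow> nat set \<Rightarrow> (nat \<Rightarrow> real set) \<Rightarrow> (nat \<Rightarrow> real) measure \<Rightarrow> ((nat \<Rightarrow> real) \<Rightarrow> real) \<Rightarrow>
   nat \<Rightarrow> nat set \<Rightarrow> real" where
  "S_score d C X P p j R =
     (\<integral>x. cond_variance (adm_law C X P j R) (\<lambda>x. x j) (curv d C X p j R) x \<partial>adm_law C X P j R)"

definition OCS ::
  "nat \<Rightarrow> nat set \<Rightarrow> (nat \<Rightarrow> real set) \<Rightarrow> (nat \<Rightarrow> real) measure \<Rightarrow> ((nat \<Rightarrow> real) \<Rightarrow> real) \<Rightarrow>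
   (nat \<Rightarrow> nat) \<Rightarrow> nat \<Rightarrow> nat \<Rightarrow> real" where
  "OCS d C X P p \<pi> j i =
     (let R = insert i (Pred d \<pi> i)
      in \<integral>x. \<bar>mixed_curv d C X p i j R x\<bar> \<partial>mixed_adm_law C X P i j R)"

definition square_integrable :: "'a measure \<Rightarrow> ('a \<Rightarrow> real) \<Rightarrow> bool" where
  "square_integrable M f \<longleftrightarrow> f \<in> borel_measurable M \<and> integrable M (\<lambda>x. (f x)\<^sup>2)"

definition curv_L2 ::
  "nat \<Rightarrow> (nat \<times> nat) set \<Rightarrow> nat set \<Rightarrow> (nat \<Rightarrow> real set) \<Rightarrow> (nat \<Rightarrow> real) measure \<Rightarrow>
   ((nat \<Rightarrow> real) \<Rightarrow> real) \<Rightarrow> bool" where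
  "curv_L2 d E C X P p \<longleftrightarrow> (\<forall>R j. ancestral d E R \<and> R \<noteq> {} \<and> j \<in> R \<longrightarrow>
     square_integrable (adm_law C X P j R) (curv d C X p j R))"

definition mixed_curv_L1 ::
  "nat \<Rightarrow> nat set \<Rightarrow> (nat \<Rightarrow> real set) \<Rightarrow> (nat \<Rightarrow> real) measure \<Rightarrow> ((nat \<Rightarrow> real) \<Rightarrow> real) \<Rightarrow>
   (nat \<Rightarrow> nat) \<Rightarrow> bool" where
  "mixed_curv_L1 d C X P p \<pi> \<longleftrightarrow> (\<forall>i\<in>{1..d}. \<forall>j\<in>Pred d \<pi> i.
     let R = insert i (Pred d \<pi> i)
     in integrable (mixed_adm_law C X P i j R) (mixed_curv d C X p i j R))"

end

theory Submission
  imports Defs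
begin

text \<open>Every set closed under parents has marginal density \<open>\<Prod>k\<in>R. p\<^sub>k\<close>, so \<open>log p\<^sub>R\<close> is a sum of
  factors. If \<open>j\<close> is a sink of \<open>R\<close>, only \<open>log b\<^sub>j\<close> (or \<open>log q\<^sub>j\<close>) survives two differences in \<open>x\<^sub>j\<close>.
  Otherwise let \<open>i\<close> be a last child of \<open>j\<close> in \<open>R\<close>: the second difference of \<open>log p\<^sub>R\<close> in \<open>x\<^sub>j\<close> is
  affine in \<open>x\<^sub>i\<close> with slope \<open>D\<^sub>j\<^sup>2 \<eta>\<^sub>i\<close>, which nonlinearity and continuity make nonzero on a box of
  positive measure; a vanishing score forces the curvature to be independent of \<open>x\<^sub>i\<close> almost surely,
  a contradiction. Likewise \<open>D\<^sub>i D\<^sub>j log p\<^sub>R\<close> is \<open>D\<^sub>j \<eta>\<^sub>i\<close> when \<open>i\<close> is last in a causal order.\<close>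

section \<open>Log-partition functions\<close>

text \<open>The operators rest on \<open>deriv\<close>, which is total, so a sum splits only where
  every summand is differentiable. For a non-sink \<open>j\<close> the summands include
  \<open>log_partition\<close> composed with the natural parameters of all children of
  \<open>j\<close>. No hypothesis states that these are smooth, so smoothness of Laplace transforms
  is derived. These terms never have to be computed. Evaluating the difference operator in
  \<open>x j\<close> at two values of \<open>x i\<close> and subtracting cancels every summand that
  does not involve both coordinates, and the choice of \<open>i\<close> leaves its own factor as the
  only one that does. Comparing two values also treats count and continuous \<open>x i\<close>
  alike. A second obstacle is that scores see only almost every point, whereas nonlinearity and
  nontriviality provide single points. The bridge is full support of the reference measures: a set
  that is a nonempty open set in each continuous coordinate and a single point in each count
  coordinate has positive measure, and the marginal laws have the same null sets as the reference
  measures.\<close>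

definition twice_diff :: "real set \<Rightarrow> (real \<Rightarrow> real) \<Rightarrow> bool" where
  "twice_diff S f \<longleftrightarrow> (\<forall>x\<in>S. f differentiable at x \<and> deriv f differentiable at x)"

lemma twice_diffD:
  assumes "twice_diff S f" "x \<in> S"
  shows "(f has_real_derivative deriv f x) (at x)"
    and "(deriv f has_real_derivative deriv (deriv f) x) (at x)"
  using assms unfolding twice_diff_def
  by (auto simp: real_differentiable_def dest: DERIV_imp_deriv)

text \<open>\<open>deriv f\<close> is known to equal \<open>f'\<close> only on \<open>S\<close>;
  openness upgrades this to equality near each point, which is what differentiating once more
  requires.\<close>

lemma twice_diffI:
  assumes S: "open S"
    and f: "\<And>x. x \<in> S \<Longrightarrow> (f has_real_derivative f' x) (at x)"
    and f': "\<And>x. x \<in> S \<Longrightarrow> (f' has_real_derivative f'' x) (at x)"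
  shows "twice_diff S f" and "\<And>x. x \<in> S \<Longrightarrow> deriv (deriv f) x = f'' x"
proof -
  have *: "(deriv f has_real_derivative f'' x) (at x)" if "x \<in> S" for x
    using f'[OF that]
    by (rule has_field_derivative_transform_within_open[OF _ S that]) (metis DERIV_imp_deriv f)
  show "twice_diff S f"
    unfolding twice_diff_def real_differentiable_def using * f by blast
  show "\<And>x. x \<in> S \<Longrightarrow> deriv (deriv f) x = f'' x"
    using * DERIV_imp_deriv by blast
qed

lemma twice_diff_cong:
  assumes "open S" "\<And>x. x \<in> S \<Longrightarrow> f x = g x" "twice_diff S g"
  shows "twice_diff S f"
proof (rule twice_diffI(1)[OF assms(1)])
  show "(f has_real_derivative deriv g x) (at x)" if "x \<in> S" for x
    using twice_diffD(1)[OF assms(3) that]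
    by (rule has_field_derivative_transform_within_open[OF _ assms(1) that]) (simp add: assms(2))
  show "(deriv g has_real_derivative deriv (deriv g) x) (at x)" if "x \<in> S" for x
    using twice_diffD(2)[OF assms(3) that] .
qed

text \<open>This is the shape in which log-densities occur along a coordinate: a remainder
  \<open>f\<close>, a multiple of a natural parameter \<open>g\<close>, and an affine part that the
  second derivative removes.\<close>

lemma twice_diff_affine_comb:
  assumes S: "open S" and f: "twice_diff S f" and g: "twice_diff S g"
  shows "twice_diff S (\<lambda>x. f x + a * g x + \<beta> * x + \<gamma>)"
    and "\<And>x. x \<in> S \<Longrightarrow> deriv (\<lambda>x. f x + a * g x + \<beta> * x + \<gamma>) x = deriv f x + a * deriv g x + \<beta>"
    and "\<And>x. x \<in> S \<Longrightarrow> deriv (deriv (\<lambda>x. f x + a * g x + \<beta> * x + \<gamma>)) x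
           = deriv (deriv f) x + a * deriv (deriv g) x"
proof -
  let ?h = "\<lambda>x. f x + a * g x + \<beta> * x + \<gamma>"
  have 1: "(?h has_real_derivative deriv f x + a * deriv g x + \<beta>) (at x)" if "x \<in> S" for x
    using that by (auto intro!: derivative_eq_intros twice_diffD(1)[OF f] twice_diffD(1)[OF g])
  have 2: "((\<lambda>x. deriv f x + a * deriv g x + \<beta>) has_real_derivative
      deriv (deriv f) x + a * deriv (deriv g) x) (at x)" if "x \<in> S" for x
    using that by (auto intro!: derivative_eq_intros twice_diffD(2)[OF f] twice_diffD(2)[OF g])
  show "twice_diff S ?h" and "\<And>x. x \<in> S \<Longrightarrow> deriv (deriv ?h) x = deriv (deriv f) x + a * deriv (deriv g) x"
    using twice_diffI[OF S 1 2] by auto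
  show "\<And>x. x \<in> S \<Longrightarrow> deriv ?h x = deriv f x + a * deriv g x + \<beta>"
    using 1 DERIV_imp_deriv by blast
qed

lemma twice_diff_const: "open S \<Longrightarrow> twice_diff S (\<lambda>x. c)"
  by (rule twice_diffI(1)[where f' = "\<lambda>x. 0" and f'' = "\<lambda>x. 0"]) auto

lemma twice_diff_add:
  assumes "open S" "twice_diff S f" "twice_diff S g"
  shows "twice_diff S (\<lambda>x. f x + g x)"
  using twice_diff_affine_comb(1)[OF assms, of 1 0 0] by simp

lemma twice_diff_sum:
  assumes "open S" "\<And>k. k \<in> K \<Longrightarrow> twice_diff S (f k)"
  shows "twice_diff S (\<lambda>x. \<Sum>k\<in>K. f k x)"
  using assms(2)
  by (induction K rule: infinite_finite_induct)
     (auto intro!: twice_diff_add twice_diff_const assms(1))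

lemma twice_diff_compose:
  assumes S: "open S" and A: "twice_diff T A" and f: "twice_diff S f" and sub: "f ` S \<subseteq> T"
  shows "twice_diff S (\<lambda>x. A (f x))"
proof (rule twice_diffI(1)[OF S])
  fix x assume x: "x \<in> S"
  then have fx: "f x \<in> T" using sub by auto
  show "((\<lambda>x. A (f x)) has_real_derivative deriv A (f x) * deriv f x) (at x)"
    using DERIV_chain2[OF twice_diffD(1)[OF A fx] twice_diffD(1)[OF f x]] by simp
  show "((\<lambda>x. deriv A (f x) * deriv f x) has_real_derivative
      deriv (deriv A) (f x) * deriv f x * deriv f x + deriv (deriv f) x * deriv A (f x)) (at x)"
    using DERIV_mult[OF DERIV_chain2[OF twice_diffD(2)[OF A fx] twice_diffD(1)[OF f x]]
        twice_diffD(2)[OF f x]] by simp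
qed

lemma twice_diff_ln:
  assumes S: "open S" and f: "twice_diff S f" and pos: "\<And>x. x \<in> S \<Longrightarrow> 0 < f x"
  shows "twice_diff S (\<lambda>x. ln (f x))"
proof (rule twice_diff_compose[OF S _ f, where T = "{0<..}"])
  show "twice_diff {0<..} ln"
    by (rule twice_diffI(1)[where f' = "\<lambda>x. inverse x" and f'' = "\<lambda>x. - (inverse x ^ Suc (Suc 0))"])
       (auto intro!: derivative_eq_intros simp: divide_inverse)
qed (use pos in auto)

text \<open>Convergence on the whole open interval passes to the differentiated series, so termwise
  differentiation can be applied twice.\<close>

lemma twice_diff_powser:
  fixes a :: "nat \<Rightarrow> real"
  assumes sm: "\<And>h. \<bar>h\<bar> < r \<Longrightarrow> (\<lambda>n. a n * h ^ n) sums f (t0 + h)"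
  shows "twice_diff {t0 - r<..<t0 + r} f"
proof (rule twice_diff_cong)
  let ?S = "{t0 - r<..<t0 + r}"
  show "f t = (\<Sum>n. a n * (t - t0) ^ n)" if "t \<in> ?S" for t
    using sm[of "t - t0"] that by (auto simp: sums_iff)
  have s0: "summable (\<lambda>n. a n * h ^ n)" if "norm h < r" for h
    using sm[of h] that by (auto simp: sums_iff)
  have s1: "summable (\<lambda>n. diffs a n * h ^ n)" if "norm h < r" for h
    using termdiff_converges[OF that s0] .
  show "twice_diff ?S (\<lambda>t. \<Sum>n. a n * (t - t0) ^ n)"
  proof (rule twice_diffI(1))
    fix t assume t: "t \<in> ?S"
    then have n: "norm (t - t0) < r" by auto
    have sh: "((\<lambda>t. t - t0) has_real_derivative 1) (at t)"
      by (auto intro!: derivative_eq_intros)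
    show "((\<lambda>t. \<Sum>n. a n * (t - t0) ^ n) has_real_derivative (\<Sum>n. diffs a n * (t - t0) ^ n)) (at t)"
      using DERIV_chain2[OF termdiffs_strong'[OF s0 n] sh] by simp
    show "((\<lambda>t. \<Sum>n. diffs a n * (t - t0) ^ n) has_real_derivative
        (\<Sum>n. diffs (diffs a) n * (t - t0) ^ n)) (at t)"
      using DERIV_chain2[OF termdiffs_strong'[OF s1 n] sh] by simp
  qed auto
qed auto

lemma twice_diff_local:
  assumes "\<And>x. x \<in> S \<Longrightarrow> \<exists>T. x \<in> T \<and> twice_diff T f"
  shows "twice_diff S f"
  using assms unfolding twice_diff_def by blast

text \<open>Expanding the exponential at \<open>t0\<close> and integrating termwise gives a power series, so the
  Laplace transform is smooth in the interior of its domain.\<close>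

lemma laplace_powser:
  assumes id: "(\<lambda>u. u) \<in> borel_measurable M"
    and nonneg: "AE u in M. 0 \<le> b u"
    and r: "0 \<le> r" and lo: "t0 - r \<in> natural_domain M b" and mid: "t0 \<in> natural_domain M b"
    and hi: "t0 + r \<in> natural_domain M b" and h: "\<bar>h\<bar> \<le> r"
  shows "(\<lambda>n. (\<integral>u. b u * exp (u * t0) * (u ^ n / fact n) \<partial>M) * h ^ n) sums
    (\<integral>u. b u * exp (u * (t0 + h)) \<partial>M)"
proof -
  note id[measurable]
  have i0[measurable]: "integrable M (\<lambda>u. b u * exp (u * t0))"
    and ilo: "integrable M (\<lambda>u. b u * exp (u * (t0 - r)))"
    and ihi: "integrable M (\<lambda>u. b u * exp (u * (t0 + r)))"
    using lo mid hi by (auto simp: natural_domain_def)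
  define g where "g u = b u * exp (u * t0)" for u
  have g_int: "integrable M g" using i0 unfolding g_def .
  note [measurable] = borel_measurable_integrable[OF g_int]
  have g0: "AE u in M. 0 \<le> g u" using nonneg by eventually_elim (simp add: g_def)
  \<comment> \<open>Both end points enter here: \<open>exp (\<bar>u\<bar> * r)\<close> is at most
    \<open>exp (u * (- r)) + exp (u * r)\<close>, which after multiplication by \<open>g u\<close>
    is a sum of two integrable functions.\<close>
  have dom: "integrable M (\<lambda>u. g u * exp (\<bar>u\<bar> * r))"
  proof (rule Bochner_Integration.integrable_bound[OF Bochner_Integration.integrable_add[OF ilo ihi]])
    show "AE u in M. norm (g u * exp (\<bar>u\<bar> * r)) \<le>
       norm (b u * exp (u * (t0 - r)) + b u * exp (u * (t0 + r)))"
      using nonneg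
    proof eventually_elim
      case (elim u)
      have "exp (\<bar>u\<bar> * r) \<le> exp (u * (- r)) + exp (u * r)"
        by (cases "0 \<le> u") (auto simp: abs_if add_increasing add_increasing2)
      then have "b u * exp (u * t0) * exp (\<bar>u\<bar> * r) \<le> b u * exp (u * t0) * (exp (u * (- r)) + exp (u * r))"
        using elim by (intro mult_left_mono) auto
      moreover have "b u * exp (u * t0) * (exp (u * (- r)) + exp (u * r)) =
          b u * exp (u * (t0 - r)) + b u * exp (u * (t0 + r))"
        by (simp add: algebra_simps exp_add[symmetric] exp_diff exp_minus) (simp add: exp_add divide_inverse)
      ultimately show ?case using elim by (simp add: g_def)
    qed
  qed measurable
  define F where "F n u = g u * (u ^ n / fact n) * h ^ n" for n u
  have Fs: "(\<lambda>n. F n u) sums (g u * exp (u * h))" for u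
  proof -
    have "(\<lambda>n. g u * ((u * h) ^ n /\<^sub>R fact n)) sums (g u * exp (u * h))"
      by (intro sums_mult exp_converges)
    then show ?thesis by (simp add: F_def power_mult_distrib divide_inverse mult_ac)
  qed
  have Fn: "(\<lambda>n. norm (F n u)) sums (\<bar>g u\<bar> * exp (\<bar>u\<bar> * \<bar>h\<bar>))" for u
  proof -
    have "(\<lambda>n. \<bar>g u\<bar> * ((\<bar>u\<bar> * \<bar>h\<bar>) ^ n /\<^sub>R fact n)) sums (\<bar>g u\<bar> * exp (\<bar>u\<bar> * \<bar>h\<bar>))"
      by (intro sums_mult exp_converges)
    then show ?thesis
      by (simp add: F_def power_mult_distrib divide_inverse mult_ac abs_mult power_abs)
  qed
  have [measurable]: "F n \<in> borel_measurable M" for n unfolding F_def by measurable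
  \<comment> \<open>One bound, uniform in \<open>N\<close>, serves twice: it dominates each single
    term and it bounds the partial sums of the integrated norms.\<close>
  have part: "(\<Sum>n<N. norm (F n u)) \<le> \<bar>g u\<bar> * exp (\<bar>u\<bar> * r)" for N u
  proof -
    have "(\<Sum>n<N. norm (F n u)) \<le> \<bar>g u\<bar> * exp (\<bar>u\<bar> * \<bar>h\<bar>)"
      using sum_le_suminf[of "\<lambda>n. norm (F n u)" "{..<N}"] Fn[of u] by (simp add: sums_iff)
    also have "\<dots> \<le> \<bar>g u\<bar> * exp (\<bar>u\<bar> * r)"
      using h by (intro mult_left_mono) (auto intro: mult_left_mono)
    finally show ?thesis .
  qed
  have dom': "integrable M (\<lambda>u. \<bar>g u\<bar> * exp (\<bar>u\<bar> * r))"
    using dom[THEN integrable_abs] by (simp add: abs_mult)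
  have Fint: "integrable M (F n)" for n
  proof (rule Bochner_Integration.integrable_bound[OF dom'])
    show "AE u in M. norm (F n u) \<le> norm (\<bar>g u\<bar> * exp (\<bar>u\<bar> * r))"
    proof (rule AE_I2)
      fix u
      have "norm (F n u) \<le> (\<Sum>k<Suc n. norm (F k u))" by (simp add: sum_nonneg)
      then show "norm (F n u) \<le> norm (\<bar>g u\<bar> * exp (\<bar>u\<bar> * r))"
        using part[where N = "Suc n" and u = u] by (simp del: sum.lessThan_Suc)
    qed
  qed measurable
  have "summable (\<lambda>n. \<integral>u. norm (F n u) \<partial>M)"
  proof (rule summableI_nonneg_bounded)
    fix N
    have "(\<Sum>n<N. \<integral>u. norm (F n u) \<partial>M) = (\<integral>u. (\<Sum>n<N. norm (F n u)) \<partial>M)"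
      by (rule Bochner_Integration.integral_sum[symmetric]) (use Fint in auto)
    also have "\<dots> \<le> (\<integral>u. \<bar>g u\<bar> * exp (\<bar>u\<bar> * r) \<partial>M)"
      using Fint by (intro integral_mono dom' part) auto
    finally show "(\<Sum>n<N. \<integral>u. norm (F n u) \<partial>M) \<le> (\<integral>u. \<bar>g u\<bar> * exp (\<bar>u\<bar> * r) \<partial>M)" .
  qed auto
  then have "(\<lambda>n. \<integral>u. F n u \<partial>M) sums (\<integral>u. (\<Sum>n. F n u) \<partial>M)"
    using Fn by (intro sums_integral[OF Fint]) (auto simp: sums_iff)
  moreover have "(\<Sum>n. F n u) = b u * exp (u * (t0 + h))" for u
    using Fs[of u] by (simp add: sums_iff g_def exp_add algebra_simps)
  moreover have "(\<integral>u. F n u \<partial>M) = (\<integral>u. b u * exp (u * t0) * (u ^ n / fact n) \<partial>M) * h ^ n" for n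
    unfolding F_def g_def by (rule integral_mult_left_zero)
  ultimately show ?thesis by simp
qed

lemma integral_pos_AE:
  fixes f :: "'a \<Rightarrow> real"
  assumes int: "integrable M f" and pos: "AE x in M. 0 < f x" and nz: "emeasure M (space M) \<noteq> 0"
  shows "0 < integral\<^sup>L M f"
proof -
  have nn: "AE x in M. 0 \<le> f x" using pos by eventually_elim simp
  have "integral\<^sup>L M f \<noteq> 0"
  proof
    assume "integral\<^sup>L M f = 0"
    then have "AE x in M. f x = 0"
      using integral_nonneg_eq_0_iff_AE[OF int nn] by simp
    with pos have "AE x in M. False" by eventually_elim simp
    with nz show False by (simp add: eventually_False ae_filter_eq_bot_iff)
  qed
  then show ?thesis using integral_nonneg_AE[OF nn] by simp
qed

text \<open>An interior point has a closed ball inside the domain, which supplies the two end points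
  needed for the power series. Positivity of the integral then allows composition with
  \<open>ln\<close>.\<close>

lemma log_partition_twice_diff:
  assumes id: "(\<lambda>u. u) \<in> borel_measurable M"
    and pos: "AE u in M. 0 < b u" and nz: "emeasure M (space M) \<noteq> 0"
  shows "twice_diff (interior (natural_domain M b)) (log_partition M b)"
  unfolding log_partition_def
proof (rule twice_diff_ln)
  show "0 < (\<integral>u. b u * exp (u * t) \<partial>M)" if "t \<in> interior (natural_domain M b)" for t
  proof (rule integral_pos_AE[OF _ _ nz])
    show "integrable M (\<lambda>u. b u * exp (u * t))"
      using that interior_subset by (auto simp: natural_domain_def)
    show "AE u in M. 0 < b u * exp (u * t)" using pos by eventually_elim simp
  qed
  show "twice_diff (interior (natural_domain M b)) (\<lambda>t. \<integral>u. b u * exp (u * t) \<partial>M)"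
  proof (rule twice_diff_local)
    fix t0 assume t0: "t0 \<in> interior (natural_domain M b)"
    then obtain r where r: "0 < r" "cball t0 r \<subseteq> natural_domain M b"
      using mem_interior_cball by blast
    have nonneg: "AE u in M. 0 \<le> b u" using pos by eventually_elim simp
    have "t0 - r \<in> cball t0 r" "t0 \<in> cball t0 r" "t0 + r \<in> cball t0 r"
      using r(1) by (auto simp: dist_real_def)
    then have n: "t0 - r \<in> natural_domain M b" "t0 \<in> natural_domain M b" "t0 + r \<in> natural_domain M b"
      using r(2) by blast+
    show "\<exists>T. t0 \<in> T \<and> twice_diff T (\<lambda>t. \<integral>u. b u * exp (u * t) \<partial>M)"
      using r(1) by (intro exI[of _ "{t0 - r<..<t0 + r}"] conjI
          twice_diff_powser[OF laplace_powser[OF id nonneg _ n]]) auto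
  qed
qed auto

section \<open>Derivatives and finite differences in one variable\<close>

text \<open>The Boolean stands for \<open>j \<in> C\<close>. Freezing all coordinates but one
  reduces \<open>D1\<close> and \<open>D2\<close> to these, so count and continuous variables share
  their lemmas.\<close>

definition d1 :: "bool \<Rightarrow> (real \<Rightarrow> real) \<Rightarrow> real \<Rightarrow> real" where
  "d1 c f t = (if c then f (t + 1) - f t else deriv f t)"

definition d2 :: "bool \<Rightarrow> (real \<Rightarrow> real) \<Rightarrow> real \<Rightarrow> real" where
  "d2 c f t = (if c then f (t + 2) - 2 * f (t + 1) + f t else deriv (deriv f) t)"

lemma D1_eq: "D1 C j f x = d1 (j \<in> C) (\<lambda>s. f (x(j := s))) (x j)"
  by (simp add: D1_def d1_def partial_def)

lemma D2_eq: "D2 C j f x = d2 (j \<in> C) (\<lambda>s. f (x(j := s))) (x j)"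
  by (simp add: D2_def d2_def partial_def)

text \<open>Count coordinates carry no regularity condition, hence the vacuous case.\<close>

definition smooth_on :: "bool \<Rightarrow> real set \<Rightarrow> (real \<Rightarrow> real) \<Rightarrow> bool" where
  "smooth_on c U f \<longleftrightarrow> c \<or> twice_diff U f"

definition steps :: "bool \<Rightarrow> nat \<Rightarrow> real set \<Rightarrow> real set" where
  "steps c r U = (if c then {t. \<forall>s\<le>r. t + real s \<in> U} else U)"

lemma adm_eq: "adm C X r j = steps (j \<in> C) r (supp_int C X j)"
  by (simp add: adm_def steps_def supp_int_def)

lemma steps_subset: "steps c r U \<subseteq> U"
  by (auto simp: steps_def split: if_splits dest: spec[of _ "0::nat"])

lemma steps_1_iff: "c \<Longrightarrow> t \<in> steps c 1 U \<longleftrightarrow> t \<in> U \<and> t + 1 \<in> U"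
  by (auto simp: steps_def le_Suc_eq)

lemma steps_2_iff: "c \<Longrightarrow> t \<in> steps c 2 U \<longleftrightarrow> t \<in> U \<and> t + 1 \<in> U \<and> t + 2 \<in> U"
  by (auto simp: steps_def le_Suc_eq numeral_2_eq_2)

lemma steps_steps: "steps c 1 (steps c 1 U) = steps c 2 U"
proof (cases c)
  case True
  then show ?thesis by (intro set_eqI) (auto simp: steps_1_iff steps_2_iff add.assoc simp del: One_nat_def)
qed (simp add: steps_def)

text \<open>Isolates the absence of gaps from \<open>count_support\<close>: it is inherited by
  \<open>steps c 1 S\<close>, whereas having at least three elements is not.\<close>

definition consecutive :: "real set \<Rightarrow> bool" where
  "consecutive S \<longleftrightarrow> S \<subseteq> \<int> \<and> (\<forall>a\<in>S. \<forall>c\<in>S. \<forall>u\<in>\<int>. a \<le> u \<and> u \<le> c \<longrightarrow> u \<in> S)"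

lemma consecutiveD:
  assumes "consecutive S"
  shows "S \<subseteq> \<int>" and "a \<in> S \<Longrightarrow> c \<in> S \<Longrightarrow> u \<in> \<int> \<Longrightarrow> a \<le> u \<Longrightarrow> u \<le> c \<Longrightarrow> u \<in> S"
  using assms unfolding consecutive_def by blast+

lemma consecutiveI:
  assumes "S \<subseteq> \<int>" and "\<And>a c u. a \<in> S \<Longrightarrow> c \<in> S \<Longrightarrow> u \<in> \<int> \<Longrightarrow> a \<le> u \<Longrightarrow> u \<le> c \<Longrightarrow> u \<in> S"
  shows "consecutive S"
  using assms unfolding consecutive_def by blast

lemma count_support_consecutive: "count_support S \<Longrightarrow> consecutive S"
  unfolding count_support_def by (intro consecutiveI) blast+

text \<open>These are domains that are connected in the sense proper to each kind of variable, so
  that a vanishing first difference or derivative forces constancy.\<close>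

definition linear_domain :: "bool \<Rightarrow> real set \<Rightarrow> bool" where
  "linear_domain c U \<longleftrightarrow> (if c then consecutive U else open U \<and> convex U)"

lemma linear_domain_steps: "linear_domain c U \<Longrightarrow> linear_domain c (steps c 1 U)"
proof (cases c)
  case True
  assume "linear_domain c U"
  with True have U: "consecutive U" by (simp add: linear_domain_def)
  have "consecutive (steps c 1 U)"
  proof (rule consecutiveI)
    show "steps c 1 U \<subseteq> \<int>" using steps_subset consecutiveD(1)[OF U] by blast
    show "u \<in> steps c 1 U" if "a \<in> steps c 1 U" "b \<in> steps c 1 U" "u \<in> \<int>" "a \<le> u" "u \<le> b" for a b u
      using that consecutiveD(2)[OF U, of a b u] consecutiveD(2)[OF U, of a "b + 1" "u + 1"]
      unfolding steps_1_iff[OF True] by simp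
  qed
  with True show ?thesis by (simp add: linear_domain_def)
qed (simp add: steps_def)

text \<open>In the count case any two points are joined by unit steps inside \<open>U\<close>,
  because \<open>U\<close> has no gaps; in the continuous case a zero derivative on a convex set is
  used.\<close>

lemma d1_zero_imp_const:
  assumes U: "linear_domain c U" and diff: "\<And>t. \<not> c \<Longrightarrow> t \<in> U \<Longrightarrow> f differentiable at t"
    and zero: "\<And>t. t \<in> steps c 1 U \<Longrightarrow> d1 c f t = 0"
    and uw: "u \<in> U" "w \<in> U"
  shows "f u = f w"
proof (cases c)
  case True
  have U': "consecutive U"
    using U True by (simp add: linear_domain_def)
  have up: "f (u + real m) = f u" if "u \<in> U" "u + real m \<in> U" for u m
    using that(2)
  proof (induction m)
    case (Suc m)
    have "u + real m \<in> U"
      using consecutiveD(2)[OF U' that(1) Suc.prems, of "u + real m"] consecutiveD(1)[OF U'] that(1) by auto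
    moreover from this have "f (u + real m + 1) = f (u + real m)"
      using zero[of "u + real m"] Suc.prems True by (simp add: d1_def steps_1_iff add_ac del: One_nat_def)
    ultimately show ?case using Suc.IH by (simp add: add_ac)
  qed simp
  have *: "f u = f w" if "u \<in> U" "w \<in> U" "u \<le> w" for u w
  proof -
    have "w - u \<in> \<int>" using that consecutiveD(1)[OF U'] by (metis Ints_diff subsetD)
    then obtain k where k: "w - u = of_int k" by (auto elim: Ints_cases)
    then have "w = u + real (nat k)" using that by auto
    then show ?thesis using up[of u "nat k"] that by auto
  qed
  show ?thesis using *[of u w] *[of w u] uw by linarith
next
  case False
  have "(f has_field_derivative 0) (at x within U)" if "x \<in> U" for x
    using zero[of x] diff[of x] that False
    by (auto simp: d1_def steps_def real_differentiable_def)
      (metis DERIV_imp_deriv has_field_derivative_at_within)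
  then show ?thesis
    using has_field_derivative_zero_constant[of U f] U uw False by (auto simp: linear_domain_def)
qed

text \<open>Constancy is applied twice: to \<open>d1 c f\<close>, whose value at some
  \<open>t0\<close> is the slope, and then to \<open>f\<close> minus its linear part. Its
  contrapositive turns failure of affinity into a point with nonzero curvature.\<close>

lemma d2_zero_imp_affine:
  assumes U: "linear_domain c U" and f: "smooth_on c U f" and ne: "steps c 1 U \<noteq> {}"
    and zero: "\<And>t. t \<in> steps c 2 U \<Longrightarrow> d2 c f t = 0"
  shows "\<exists>\<alpha> \<beta>. \<forall>t\<in>U. f t = \<alpha> * t + \<beta>"
proof -
  obtain t0 where t0: "t0 \<in> steps c 1 U" using ne by auto
  define \<alpha> where "\<alpha> = d1 c f t0"
  have d2_d1: "d2 c f t = d1 c (d1 c f) t" for t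
    by (simp add: d1_def[abs_def] d2_def add.assoc)
  have "d1 c f t = \<alpha>" if "t \<in> steps c 1 U" for t
    unfolding \<alpha>_def
  proof (rule d1_zero_imp_const[OF linear_domain_steps[OF U] _ _ that t0])
    show "d1 c f differentiable at t" if "\<not> c" "t \<in> steps c 1 U" for t
      using f that by (auto simp: smooth_on_def twice_diff_def steps_def d1_def[abs_def])
    show "d1 c (d1 c f) t = 0" if "t \<in> steps c 1 (steps c 1 U)" for t
      using zero that unfolding steps_steps d2_d1 by blast
  qed
  moreover have "d1 c (\<lambda>t. f t - \<alpha> * t) t = d1 c f t - \<alpha>" if "t \<in> steps c 1 U" for t
  proof (cases c)
    case False
    then have "(f has_real_derivative deriv f t) (at t)"
      using f that by (auto simp: smooth_on_def steps_def intro: twice_diffD)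
    then have "((\<lambda>t. f t - \<alpha> * t) has_real_derivative deriv f t - \<alpha>) (at t)"
      by (auto intro!: derivative_eq_intros)
    then show ?thesis using False by (auto simp: d1_def dest: DERIV_imp_deriv)
  qed (simp add: d1_def algebra_simps)
  ultimately have "f t - \<alpha> * t = f t0 - \<alpha> * t0" if "t \<in> U" for t
    using t0 steps_subset[of c 1 U] f
    by (intro d1_zero_imp_const[OF U _ _ that]) (auto simp: smooth_on_def twice_diff_def intro!: derivative_intros)
  then show ?thesis by (intro exI[of _ \<alpha>] exI[of _ "f t0 - \<alpha> * t0"]) (auto simp: algebra_simps)
qed

text \<open>The representation of \<open>f\<close> holds on \<open>U\<close> only. Membership in
  \<open>steps\<close> keeps all shifted points in \<open>U\<close>, and openness makes the
  representation hold near \<open>t\<close> when derivatives are taken.\<close>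

lemma
  assumes U: "linear_domain c U" and g: "smooth_on c U g" and h: "smooth_on c U h"
    and f: "\<And>s. s \<in> U \<Longrightarrow> f s = g s + a * h s + \<beta> * s + \<gamma>"
  shows d1_affine_comb: "t \<in> steps c 1 U \<Longrightarrow> d1 c f t = d1 c g t + a * d1 c h t + \<beta>"
    and d2_affine_comb: "t \<in> steps c 2 U \<Longrightarrow> d2 c f t = d2 c g t + a * d2 c h t"
proof -
  have "(t \<in> steps c 1 U \<longrightarrow> d1 c f t = d1 c g t + a * d1 c h t + \<beta>) \<and>
        (t \<in> steps c 2 U \<longrightarrow> d2 c f t = d2 c g t + a * d2 c h t)"
  proof (cases c)
    case True
    then show ?thesis
      by (auto simp: steps_1_iff steps_2_iff d1_def d2_def f algebra_simps simp del: One_nat_def)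
  next
    case False
    then have oU: "open U" and g: "twice_diff U g" and h: "twice_diff U h"
      using U g h by (auto simp: linear_domain_def smooth_on_def)
    let ?k = "\<lambda>s. g s + a * h s + \<beta> * s + \<gamma>"
    note k = twice_diff_affine_comb[OF oU g h, where a = a and \<beta> = \<beta> and \<gamma> = \<gamma>]
    have ev: "eventually (\<lambda>s. s \<in> U) (nhds t)" if "t \<in> U" for t
      using oU that by (rule eventually_nhds_in_open)
    have d: "deriv f t = deriv ?k t" if "t \<in> U" for t
      using ev[OF that] by (intro deriv_cong_ev) (auto elim!: eventually_mono simp: f)
    have "deriv (deriv f) t = deriv (deriv ?k) t" if "t \<in> U" for t
      using ev[OF that] by (intro deriv_cong_ev) (auto elim!: eventually_mono simp: d)
    then show ?thesis using False d k by (auto simp: d1_def d2_def steps_def)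
  qed
  then show "t \<in> steps c 1 U \<Longrightarrow> d1 c f t = d1 c g t + a * d1 c h t + \<beta>"
    and "t \<in> steps c 2 U \<Longrightarrow> d2 c f t = d2 c g t + a * d2 c h t" by auto
qed

lemma smooth_on_sum:
  "linear_domain c U \<Longrightarrow> (\<And>k. k \<in> K \<Longrightarrow> smooth_on c U (f k)) \<Longrightarrow> smooth_on c U (\<lambda>x. \<Sum>k\<in>K. f k x)"
  by (auto simp: smooth_on_def linear_domain_def intro!: twice_diff_sum)

lemma smooth_on_const: "linear_domain c U \<Longrightarrow> smooth_on c U (\<lambda>x. k)"
  by (auto simp: smooth_on_def linear_domain_def intro!: twice_diff_const)

lemma smooth_on_affine_comb:
  "linear_domain c U \<Longrightarrow> smooth_on c U f \<Longrightarrow> smooth_on c U g \<Longrightarrow>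
    smooth_on c U (\<lambda>x. f x + a * g x + \<beta> * x + \<gamma>)"
  by (auto simp: smooth_on_def linear_domain_def intro!: twice_diff_affine_comb)

lemma smooth_on_cong:
  "linear_domain c U \<Longrightarrow> (\<And>x. x \<in> U \<Longrightarrow> f x = g x) \<Longrightarrow> smooth_on c U g \<Longrightarrow> smooth_on c U f"
  by (auto simp: smooth_on_def linear_domain_def intro: twice_diff_cong)

text \<open>Among three distinct integers the least and the greatest differ by at least 2; the
  absence of gaps then gives the two successors of the least one.\<close>

lemma count_support_three:
  assumes "count_support S"
  obtains a where "a \<in> S" "a + 1 \<in> S" "a + 2 \<in> S"
proof -
  have S: "consecutive S"
    using assms by (rule count_support_consecutive)
  obtain T where T: "T \<subseteq> S" "card T = 3" "finite T"
    using assms by (metis count_support_def infinite_arbitrarily_large obtain_subset_with_card_n finite_subset)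
  then obtain a b c where abc: "T = {a, b, c}" "a \<noteq> b" "b \<noteq> c" "a \<noteq> c"
    by (metis card_3_iff)
  have *: "\<exists>a. a \<in> S \<and> a + 1 \<in> S \<and> a + 2 \<in> S" if "a \<in> S" "b \<in> S" "c \<in> S" "a < b" "b < c" for a b c
  proof -
    have int: "a \<in> \<int>" "b \<in> \<int>" "c \<in> \<int>" using consecutiveD(1)[OF S] that by blast+
    obtain i where i: "a = of_int i" using int(1) by (rule Ints_cases)
    obtain j where j: "b = of_int j" using int(2) by (rule Ints_cases)
    obtain k where k: "c = of_int k" using int(3) by (rule Ints_cases)
    have "i + 2 \<le> k" using that(4,5) unfolding i j k by simp
    then have "a + 2 \<le> c" unfolding i j k by linarith
    moreover have "a + 1 \<in> \<int>" "a + 2 \<in> \<int>" using int by auto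
    ultimately show ?thesis using consecutiveD(2)[OF S, of a c "a + 1"] consecutiveD(2)[OF S, of a c "a + 2"] that by auto
  qed
  have in_S: "a \<in> S" "b \<in> S" "c \<in> S" using T abc by auto
  consider "a < b" "b < c" | "a < c" "c < b" | "b < a" "a < c" | "b < c" "c < a"
    | "c < a" "a < b" | "c < b" "b < a"
    using abc(2-4) by (metis linorder_less_linear)
  then have "\<exists>a. a \<in> S \<and> a + 1 \<in> S \<and> a + 2 \<in> S"
  proof cases
    case 1 with in_S show ?thesis by (intro *[of a b c])
  next
    case 2 with in_S show ?thesis by (intro *[of a c b])
  next
    case 3 with in_S show ?thesis by (intro *[of b a c])
  next
    case 4 with in_S show ?thesis by (intro *[of b c a])
  next
    case 5 with in_S show ?thesis by (intro *[of c a b])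
  next
    case 6 with in_S show ?thesis by (intro *[of c b a])
  qed
  then show ?thesis using that by blast
qed

section \<open>Marginal laws of parent-closed sets\<close>

lemma cond_dens_cong:
  assumes "x k = y k" "\<And>l. l \<in> Pa E k \<Longrightarrow> x l = y l"
  shows "cond_dens E C X q b \<eta> k x = cond_dens E C X q b \<eta> k y"
proof -
  have "restrict x (Pa E k) = restrict y (Pa E k)" using assms(2) by (auto simp: restrict_def)
  then show ?thesis using assms(1) by (simp add: cond_dens_def)
qed

text \<open>Tonelli for null sets. As \<open>Q\<close> is an arbitrary predicate, the integration is
  done over a measurable null set \<open>N\<close> that covers its exceptional points.\<close>

lemma (in product_sigma_finite) AE_PiM_insert:
  assumes I: "finite I" "i \<notin> I" and Q: "AE x in Pi\<^sub>M (insert i I) M. Q x"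
  shows "AE x in Pi\<^sub>M I M. AE y in M i. Q (x(i := y))"
proof -
  obtain N where N: "{x \<in> space (Pi\<^sub>M (insert i I) M). \<not> Q x} \<subseteq> N"
    "emeasure (Pi\<^sub>M (insert i I) M) N = 0" "N \<in> sets (Pi\<^sub>M (insert i I) M)"
    using Q by (rule AE_E)
  note [measurable] = N(3)
  interpret I: finite_product_sigma_finite M I by standard fact
  have upd: "(\<lambda>y. x(i := y)) \<in> measurable (M i) (Pi\<^sub>M (insert i I) M)" if "x \<in> space (Pi\<^sub>M I M)" for x
    using measurable_component_update[OF that I(2)] .
  have "(\<integral>\<^sup>+x. (\<integral>\<^sup>+y. indicator N (x(i := y)) \<partial>M i) \<partial>Pi\<^sub>M I M) = 0"
    using product_nn_integral_insert[OF I, of "indicator N"] N(2,3) by simp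
  moreover have "(\<lambda>x. \<integral>\<^sup>+y. indicator N (x(i := y)) \<partial>M i) \<in> borel_measurable (Pi\<^sub>M I M)"
    by measurable
  ultimately have "AE x in Pi\<^sub>M I M. (\<integral>\<^sup>+y. indicator N (x(i := y)) \<partial>M i) = 0"
    by (simp add: nn_integral_0_iff_AE)
  then show ?thesis
    using AE_space
  proof eventually_elim
    case (elim x)
    have "(\<lambda>y. indicator N (x(i := y)) :: ennreal) \<in> borel_measurable (M i)"
      using upd[OF elim(2)] by measurable
    then have "AE y in M i. (indicator N (x(i := y)) :: ennreal) = 0"
      using elim(1) by (simp add: nn_integral_0_iff_AE)
    then show ?case
      using AE_space
    proof eventually_elim
      case (elim y)
      then have "x(i := y) \<in> space (Pi\<^sub>M (insert i I) M)"
        using measurable_space[OF upd[OF \<open>x \<in> space (Pi\<^sub>M I M)\<close>]] by blast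
      with elim(1) N(1) show ?case by (auto simp: indicator_def split: if_splits)
    qed
  qed
qed

section \<open>Reference measures and their full support\<close>

context regular_glm_dag
begin

text \<open>The locale \<open>product_sigma_finite\<close> asks for sigma-finiteness at every
  natural number, but \<open>X\<close> is unconstrained outside \<open>{1..d}\<close>; the empty
  counting measure fills in there.\<close>

definition nu :: "nat \<Rightarrow> real measure" where
  "nu j = (if j \<in> {1..d} then ref_measure C X j else count_space {})"

lemma PiM_ref: "I \<subseteq> {1..d} \<Longrightarrow> Pi\<^sub>M I (ref_measure C X) = Pi\<^sub>M I nu"
  by (rule PiM_cong) (auto simp: nu_def)

lemma nu_count: "j \<in> {1..d} \<Longrightarrow> j \<in> C \<Longrightarrow> nu j = count_space (X j)"
  by (simp add: nu_def ref_measure_def)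

lemma nu_cont: "j \<in> {1..d} \<Longrightarrow> j \<notin> C \<Longrightarrow> nu j = restrict_space lborel (X j)"
  by (simp add: nu_def ref_measure_def)

lemma X_borel: "j \<in> {1..d} \<Longrightarrow> j \<notin> C \<Longrightarrow> X j \<in> sets borel"
  using continuous_var[of j] real_interval_borel_measurable by (auto simp: continuous_support_def)

lemma X_countable: "j \<in> {1..d} \<Longrightarrow> j \<in> C \<Longrightarrow> countable (X j)"
  using count_var[of j] countable_int countable_subset by (auto simp: count_support_def)

sublocale nu: product_sigma_finite nu
proof
  fix j
  have "sigma_finite_measure (nu j)"
  proof (cases "j \<in> {1..d}")
    case True
    show ?thesis
    proof (cases "j \<in> C")
      case False
      with True show ?thesis
        using X_borel by (simp add: nu_cont sigma_finite_measure_restrict_space sigma_finite_lborel)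
    qed (use True in \<open>simp add: nu_count X_countable sigma_finite_measure_count_space_countable\<close>)
  next
    case False
    have "nu j = count_space {}" unfolding nu_def by (simp only: False if_False)
    then show ?thesis by (simp add: sigma_finite_measure_count_space_countable)
  qed
  then show "\<exists>A. countable A \<and> A \<subseteq> sets (nu j) \<and> \<Union> A = space (nu j) \<and> (\<forall>a\<in>A. emeasure (nu j) a \<noteq> \<infinity>)"
    by (rule sigma_finite_measure.sigma_finite_countable)
qed

lemma space_nu: "j \<in> {1..d} \<Longrightarrow> space (nu j) = X j"
  by (cases "j \<in> C") (auto simp: nu_count nu_cont space_restrict_space)

lemma supp_int_subset: "supp_int C X j \<subseteq> X j"
  by (auto simp: supp_int_def interior_subset[THEN subsetD])

lemma id_measurable_nu: "j \<in> {1..d} \<Longrightarrow> (\<lambda>u. u) \<in> borel_measurable (nu j)"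
  by (cases "j \<in> C") (auto simp: nu_count nu_cont intro: measurable_restrict_space1)

lemma open_Int_supp_sets:
  "j \<in> {1..d} \<Longrightarrow> open B \<Longrightarrow> B \<inter> supp_int C X j \<in> sets (nu j)"
  using supp_int_subset[of j] X_borel[of j]
  by (cases "j \<in> C") (auto simp: nu_count nu_cont supp_int_def sets_restrict_space_iff)

lemma supp_int_sets: "j \<in> {1..d} \<Longrightarrow> supp_int C X j \<in> sets (nu j)"
  using open_Int_supp_sets[of j UNIV] by simp

text \<open>Counting measure charges every point and Lebesgue measure every nonempty open set, so an
  inequality that persists nearby holds with positive measure.\<close>

lemma emeasure_nu_pos:
  assumes j: "j \<in> {1..d}" and B: "open B" and ne: "B \<inter> supp_int C X j \<noteq> {}"
  shows "emeasure (nu j) (B \<inter> supp_int C X j) \<noteq> 0"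
proof (cases "j \<in> C")
  case True
  have "B \<inter> supp_int C X j \<subseteq> X j" using supp_int_subset by auto
  then show ?thesis using j True ne by (simp add: nu_count emeasure_count_space_eq_0)
next
  case False
  have "B \<inter> supp_int C X j \<subseteq> X j" using supp_int_subset by auto
  then have "emeasure (nu j) (B \<inter> supp_int C X j) = emeasure lborel (B \<inter> supp_int C X j)"
    using j False X_borel[of j] by (simp add: nu_cont emeasure_restrict_space)
  moreover have "open (B \<inter> supp_int C X j)" using B False by (auto simp: supp_int_def)
  ultimately show ?thesis using ne open_not_negligible[of "B \<inter> supp_int C X j"]
    by (auto simp: negligible_iff_null_sets null_sets_completion_iff null_sets_def)
qed

lemma emeasure_nu_singleton: "j \<in> {1..d} \<Longrightarrow> j \<in> C \<Longrightarrow> t \<in> X j \<Longrightarrow> emeasure (nu j) {t} \<noteq> 0"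
  by (simp add: nu_count emeasure_count_space_eq_0)

lemma supp_int_nonempty: "j \<in> {1..d} \<Longrightarrow> supp_int C X j \<noteq> {}"
  using continuous_var[of j] count_var[of j] count_support_three[of "X j"]
  by (cases "j \<in> C") (auto simp: supp_int_def continuous_support_def)

text \<open>Only boundary points of an interval are lost, and the frontier of a convex set is
  Lebesgue null.\<close>

lemma AE_supp_int:
  assumes j: "j \<in> {1..d}"
  shows "AE u in nu j. u \<in> supp_int C X j"
proof (cases "j \<in> C")
  case True
  then show ?thesis unfolding nu_count[OF j True] by (simp add: AE_count_space supp_int_def)
next
  case False
  have "convex (X j)"
    using continuous_var[of j] j False by (simp add: continuous_support_def is_interval_convex)
  then have "frontier (X j) \<in> null_sets lborel"
    using negligible_convex_frontier[of "X j"] frontier_closed[of "X j"]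
    by (simp add: negligible_iff_null_sets null_sets_completion_iff borel_closed)
  then have "AE u in lborel. u \<notin> frontier (X j)" by (rule AE_not_in)
  then have "AE u in lborel. u \<in> X j \<longrightarrow> u \<in> interior (X j)"
    by eventually_elim (use closure_subset in \<open>auto simp: frontier_def\<close>)
  then show ?thesis
    unfolding nu_cont[OF j False] using X_borel[OF j False] False
    by (simp add: AE_restrict_space_iff supp_int_def)
qed

lemma AE_prod_int:
  assumes I: "I \<subseteq> {1..d}"
  shows "AE x in Pi\<^sub>M I nu. x \<in> prod_int C X I"
proof -
  have fin: "finite I" using I finite_subset by blast
  have "AE x in Pi\<^sub>M I nu. x k \<in> supp_int C X k" if k: "k \<in> I" for k
  proof -
    have kV: "k \<in> {1..d}" using k I by blast
    obtain N where N: "{u \<in> space (nu k). u \<notin> supp_int C X k} \<subseteq> N" "emeasure (nu k) N = 0" "N \<in> sets (nu k)"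
      using AE_supp_int[OF kV] by (rule AE_E)
    let ?A = "\<lambda>l. if l = k then N else space (nu l)"
    have "emeasure (Pi\<^sub>M I nu) (Pi\<^sub>E I ?A) = (\<Prod>l\<in>I. emeasure (nu l) (?A l))"
      using N(3) by (intro nu.emeasure_PiM fin) auto
    \<comment> \<open>The zero factor at \<open>k\<close> annihilates the product even if other
      factors are infinite.\<close>
    also have "\<dots> = 0" using k fin N(2) by (intro prod_zero) auto
    finally have "Pi\<^sub>E I ?A \<in> null_sets (Pi\<^sub>M I nu)"
      using N(3) fin by (intro null_setsI sets_PiM_I_finite) auto
    then show ?thesis
    proof (rule AE_I', intro subsetI)
      fix x assume "x \<in> {x \<in> space (Pi\<^sub>M I nu). x k \<notin> supp_int C X k}"
      then show "x \<in> Pi\<^sub>E I ?A" using N(1) k by (auto simp: space_PiM PiE_iff)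
    qed
  qed
  then have "AE x in Pi\<^sub>M I nu. \<forall>k\<in>I. x k \<in> supp_int C X k"
    using fin by (simp add: AE_finite_all)
  then show ?thesis using AE_space
    by eventually_elim (auto simp: prod_int_def space_PiM PiE_iff)
qed

lemma box_pos:
  assumes I: "I \<subseteq> {1..d}" and A: "\<And>k. k \<in> I \<Longrightarrow> A k \<in> sets (nu k)"
    and pos: "\<And>k. k \<in> I \<Longrightarrow> emeasure (nu k) (A k) \<noteq> 0"
  shows "Pi\<^sub>E I A \<in> sets (Pi\<^sub>M I nu)" and "emeasure (Pi\<^sub>M I nu) (Pi\<^sub>E I A) \<noteq> 0"
proof -
  have fin: "finite I" using I finite_subset by blast
  show "Pi\<^sub>E I A \<in> sets (Pi\<^sub>M I nu)" using fin A by (intro sets_PiM_I_finite) auto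
  show "emeasure (Pi\<^sub>M I nu) (Pi\<^sub>E I A) \<noteq> 0"
    using nu.emeasure_PiM[OF fin A] fin pos by (auto simp: prod_zero_iff)
qed

text \<open>A box of positive measure cannot lie inside a null set; this is how almost-everywhere
  statements yield concrete points.\<close>

lemma AE_obtains_in_box:
  assumes I: "I \<subseteq> {1..d}" and A: "\<And>k. k \<in> I \<Longrightarrow> A k \<in> sets (nu k)"
    and pos: "\<And>k. k \<in> I \<Longrightarrow> emeasure (nu k) (A k) \<noteq> 0"
    and Q: "AE x in Pi\<^sub>M I nu. Q x"
  obtains x where "x \<in> Pi\<^sub>E I A" "Q x"
proof (rule ccontr)
  assume "\<not> thesis"
  then have "\<And>x. x \<in> Pi\<^sub>E I A \<Longrightarrow> \<not> Q x" using that by blast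
  then have "AE x in Pi\<^sub>M I nu. x \<notin> Pi\<^sub>E I A" using Q by (auto elim: eventually_mono)
  then show False
    using box_pos[OF I A pos] AE_iff_null_sets[OF box_pos(1)[OF I A pos]] by auto
qed

text \<open>Under counting measure almost everywhere means everywhere, and under Lebesgue measure
  one more point may be discarded. The two values serve to compare curvatures at different
  \<open>x i\<close>.\<close>

lemma AE_nu_two:
  assumes i: "i \<in> {1..d}" and P: "AE u in nu i. Q u"
  obtains u w where "u \<in> supp_int C X i" "w \<in> supp_int C X i" "u \<noteq> w" "Q u" "Q w"
proof (cases "i \<in> C")
  case True
  obtain a where "a \<in> X i" "a + 1 \<in> X i"
    using count_support_three[of "X i"] count_var[of i] i True by blast
  moreover have "\<forall>u\<in>X i. Q u" using P unfolding nu_count[OF i True] by (simp add: AE_count_space)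
  ultimately show ?thesis using that[of a "a + 1"] True by (auto simp: supp_int_def)
next
  case False
  have ex: "\<exists>u. R u" if "AE u in nu i. R u" for R
  proof (rule ccontr)
    assume "\<nexists>u. R u"
    then have "AE u in nu i. False" using that by simp
    then have "emeasure (nu i) (space (nu i)) = 0" by (simp add: eventually_False ae_filter_eq_bot_iff)
    moreover have "emeasure (nu i) (supp_int C X i) \<le> emeasure (nu i) (space (nu i))"
      by (rule emeasure_space)
    ultimately show False
      using emeasure_nu_pos[OF i, of UNIV] supp_int_nonempty[OF i] by simp
  qed
  have 1: "AE u in nu i. u \<in> supp_int C X i \<and> Q u" using AE_supp_int[OF i] P by eventually_elim simp
  obtain u where u: "u \<in> supp_int C X i \<and> Q u" using ex[OF 1] by blast
  have "AE w in lborel. w \<noteq> u" by (rule AE_lborel_singleton)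
  then have "AE w in nu i. w \<noteq> u"
    unfolding nu_cont[OF i False] using X_borel[OF i False]
    by (auto simp: AE_restrict_space_iff elim: eventually_mono)
  with 1 have "AE w in nu i. (w \<in> supp_int C X i \<and> Q w) \<and> w \<noteq> u" by eventually_elim simp
  from ex[OF this] u that show ?thesis by blast
qed


text \<open>The form of ancestrality used throughout: it covers the sets generated by
  \<open>ancestral\<close> as well as the sets \<open>insert i (Pred d \<pi> i)\<close> of a causal
  order.\<close>

definition parent_closed :: "nat set \<Rightarrow> bool" where
  "parent_closed R \<longleftrightarrow> R \<subseteq> {1..d} \<and> (\<forall>k\<in>R. Pa E k \<subseteq> R)"

abbreviation factor :: "nat \<Rightarrow> (nat \<Rightarrow> real) \<Rightarrow> real" where
  "factor \<equiv> cond_dens E C X q b \<eta>"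

section \<open>Conditional densities and marginal densities\<close>

lemma Pa_subset: "Pa E k \<subseteq> {1..d}"
  using dag by (auto simp: is_dag_def Pa_def)

lemma edge_in: "(k, j) \<in> E \<Longrightarrow> k \<in> {1..d} \<and> j \<in> {1..d}"
  using dag by (auto simp: is_dag_def)

lemma not_own_parent: "k \<notin> Pa E k"
  using dag by (auto simp: is_dag_def Pa_def acyclic_def)

lemma wf_E: "wf E"
  using dag finite_subset[of E "{1..d} \<times> {1..d}"]
  by (auto simp: is_dag_def intro: finite_acyclic_wf)

lemma wf_E_converse: "wf (E\<inverse>)"
  using dag finite_subset[of E "{1..d} \<times> {1..d}"]
  by (auto simp: is_dag_def intro: finite_acyclic_wf_converse)

lemma prod_int_restrict: "x \<in> prod_int C X R \<Longrightarrow> A \<subseteq> R \<Longrightarrow> restrict x A \<in> prod_int C X A"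
  by (auto simp: prod_int_def)

lemma eta_in_domain:
  "k \<in> {1..d} \<Longrightarrow> Pa E k \<noteq> {} \<Longrightarrow> z \<in> prod_int C X (Pa E k) \<Longrightarrow>
    \<eta> k z \<in> interior (natural_domain (nu k) (b k))"
  using eta_range[of k] by (auto simp: nu_def)

lemma factor_eq: "k \<in> {1..d} \<Longrightarrow> factor k x = (if Pa E k = {} then q k (x k)
  else b k (x k) * exp (x k * \<eta> k (restrict x (Pa E k)) - log_partition (nu k) (b k) (\<eta> k (restrict x (Pa E k)))))"
  by (simp add: cond_dens_def nu_def)

lemma factor_pos:
  assumes "k \<in> {1..d}" "x k \<in> supp_int C X k"
  shows "0 < factor k x"
  using assms q_pos[of k "x k"] b_pos[of k "x k"] by (simp add: factor_eq del: atLeastAtMost_iff)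

lemma AE_b_pos: "k \<in> {1..d} \<Longrightarrow> Pa E k \<noteq> {} \<Longrightarrow> AE u in nu k. 0 < b k u"
  using AE_supp_int[of k] b_pos[of k] by (auto elim!: eventually_mono)

lemma nu_space_pos: "k \<in> {1..d} \<Longrightarrow> emeasure (nu k) (space (nu k)) \<noteq> 0"
  using emeasure_nu_pos[of k UNIV] supp_int_nonempty[of k] emeasure_space[of "nu k" "supp_int C X k"]
  by auto

text \<open>Subtracting the log-partition function in the exponent is division by the normalizing
  integral, which is finite by \<open>eta_range\<close> and positive because \<open>b k\<close> is;
  \<open>k\<close> is not its own parent, so the natural parameter stays fixed as \<open>u\<close>
  varies.\<close>

lemma factor_nn_integral:
  assumes k: "k \<in> {1..d}" and x: "restrict x (Pa E k) \<in> prod_int C X (Pa E k)"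
  shows "(\<lambda>u. factor k (x(k := u))) \<in> borel_measurable (nu k)"
    and "(\<integral>\<^sup>+u. ennreal (factor k (x(k := u))) \<partial>nu k) = 1"
proof -
  have r: "restrict (x(k := u)) (Pa E k) = restrict x (Pa E k)" for u
    using not_own_parent by (auto simp: restrict_def)
  let ?g = "\<lambda>u. factor k (x(k := u))"
  have "integrable (nu k) ?g \<and> (\<integral>u. ?g u \<partial>nu k) = 1"
  proof (cases "Pa E k = {}")
    case True
    then show ?thesis using source_density[OF k True] k by (simp add: factor_eq nu_def)
  next
    case False
    let ?e = "\<eta> k (restrict x (Pa E k))"
    let ?h = "\<lambda>u. b k u * exp (u * ?e)"
    have e: "?e \<in> natural_domain (nu k) (b k)"
      using eta_in_domain[OF k False x] interior_subset by blast
    then have i: "integrable (nu k) ?h" by (simp add: natural_domain_def)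
    have pos: "AE u in nu k. 0 < ?h u" using AE_b_pos[OF k False] by eventually_elim simp
    have Z: "0 < (\<integral>u. ?h u \<partial>nu k)" by (rule integral_pos_AE[OF i pos nu_space_pos[OF k]])
    have "?g = (\<lambda>u. ?h u / (\<integral>u. ?h u \<partial>nu k))"
      using Z False k by (auto simp: factor_eq r log_partition_def exp_diff)
    then show ?thesis using i Z by simp
  qed
  then have i: "integrable (nu k) ?g" and I: "(\<integral>u. ?g u \<partial>nu k) = 1" by auto
  show "?g \<in> borel_measurable (nu k)" using i by auto
  have "AE u in nu k. 0 \<le> ?g u"
    using AE_supp_int[OF k] by eventually_elim (auto intro!: less_imp_le factor_pos k)
  then show "(\<integral>\<^sup>+u. ennreal (?g u) \<partial>nu k) = 1"
    using nn_integral_eq_integral[OF i] I by simp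
qed

lemma p_measurable_nu: "p \<in> borel_measurable (Pi\<^sub>M {1..d} nu)"
  using p_measurable by (simp add: PiM_ref)

lemma merge_section_measurable:
  assumes R: "R \<subseteq> {1..d}" and x: "x \<in> space (Pi\<^sub>M R nu)"
  shows "(\<lambda>y. p (merge R ({1..d} - R) (x, y))) \<in> borel_measurable (Pi\<^sub>M ({1..d} - R) nu)"
proof -
  have "R \<union> ({1..d} - R) = {1..d}" using R by blast
  then have "merge R ({1..d} - R) \<in> measurable (Pi\<^sub>M R nu \<Otimes>\<^sub>M Pi\<^sub>M ({1..d} - R) nu) (Pi\<^sub>M {1..d} nu)"
    using measurable_merge[of R "{1..d} - R" nu] by simp
  then show ?thesis
    using measurable_compose[OF measurable_Pair1'[OF x] measurable_compose[OF _ p_measurable_nu]] by simp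
qed

lemma prod_int_space: "R \<subseteq> {1..d} \<Longrightarrow> x \<in> prod_int C X R \<Longrightarrow> x \<in> space (Pi\<^sub>M R nu)"
  using supp_int_subset space_nu by (auto simp: prod_int_def space_PiM PiE_iff subset_iff)

text \<open>Induction on the number of missing nodes: a minimal missing node \<open>s\<close> is a sink of
  \<open>insert s R\<close>, and its conditional density integrates to 1.\<close>

lemma nn_integral_marginal:
  assumes "parent_closed R" "x \<in> prod_int C X R"
  shows "(\<integral>\<^sup>+y. ennreal (p (merge R ({1..d} - R) (x, y))) \<partial>Pi\<^sub>M ({1..d} - R) nu)
    = ennreal (\<Prod>k\<in>R. factor k x)"
  using assms
proof (induction "card ({1..d} - R)" arbitrary: R x)
  case 0
  then have "{1..d} - R = {}" by (metis card_eq_0_iff finite_Diff finite_atLeastAtMost)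
  then have R: "R = {1..d}" using 0(2) by (auto simp: parent_closed_def)
  have "merge R {} (x, \<lambda>_. undefined) = x"
    using 0(3) by (auto simp: merge_def prod_int_def PiE_iff extensional_def)
  then show ?case using 0(3) by (simp add: R nu.nn_integral_empty factorization)
next
  case (Suc n)
  note R = Suc.prems(1)
  have "{1..d} - R \<noteq> {}" using Suc.hyps(2) by (metis card.empty nat.distinct(1))
  \<comment> \<open>By minimality no parent of \<open>s\<close> is missing, so
    \<open>insert s R\<close> is again parent-closed and the natural parameter of \<open>s\<close>
    is determined by \<open>x\<close>.\<close>
  then obtain s where s: "s \<in> {1..d} - R" and min: "\<And>l. (l, s) \<in> E \<Longrightarrow> l \<notin> {1..d} - R"
    using wfE_min'[OF wf_E] by metis
  have RV: "R \<subseteq> {1..d}" using R by (simp add: parent_closed_def)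
  have sV: "s \<in> {1..d}" "s \<notin> R" using s by auto
  have PaR: "Pa E s \<subseteq> R" using min Pa_subset[of s] by (auto simp: Pa_def)
  define R' where "R' = insert s R"
  have R': "parent_closed R'" using R PaR sV by (auto simp: R'_def parent_closed_def)
  have VR: "{1..d} - R = insert s ({1..d} - R')" using sV by (auto simp: R'_def)
  have fin: "finite ({1..d} - R')" and sn: "s \<notin> {1..d} - R'" by (auto simp: R'_def)
  have "card ({1..d} - R) = Suc (card ({1..d} - R'))"
    unfolding VR using fin sn by (rule card_insert_disjoint)
  then have card: "n = card ({1..d} - R')" using Suc.hyps(2) by simp
  have xs: "x(s := u) \<in> prod_int C X R'" if "u \<in> supp_int C X s" for u
    using Suc.prems(2) that sV by (auto simp: prod_int_def R'_def PiE_iff extensional_def)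
  have meas: "(\<lambda>y. ennreal (p (merge R ({1..d} - R) (x, y)))) \<in> borel_measurable (Pi\<^sub>M (insert s ({1..d} - R')) nu)"
    using merge_section_measurable[OF RV prod_int_space[OF RV Suc.prems(2)]] unfolding VR by simp
  have mrg: "merge R ({1..d} - R) (x, y(s := u)) = merge R' ({1..d} - R') (x(s := u), y)" for u y
    using sV by (auto simp: merge_def R'_def fun_eq_iff)
  \<comment> \<open>Parent-closedness of \<open>R\<close> forbids \<open>s \<notin> R\<close> as a
    parent of a node of \<open>R\<close>, so these factors come out of the integral over
    \<open>u\<close>.\<close>
  have factor_R: "(\<Prod>k\<in>R. factor k (x(s := u))) = (\<Prod>k\<in>R. factor k x)" for u
  proof (rule prod.cong[OF refl], rule cond_dens_cong)
    fix k assume k: "k \<in> R"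
    show "(x(s := u)) k = x k" using k sV by auto
    show "(x(s := u)) l = x l" if "l \<in> Pa E k" for l using that k sV R by (auto simp: parent_closed_def)
  qed
  have pos: "0 \<le> (\<Prod>k\<in>R. factor k x)"
    using Suc.prems(2) RV by (intro prod_nonneg ballI less_imp_le factor_pos) (auto simp: prod_int_def)
  have resx: "restrict x (Pa E s) \<in> prod_int C X (Pa E s)"
    using prod_int_restrict[OF Suc.prems(2) PaR] .
  have "(\<integral>\<^sup>+y. ennreal (p (merge R ({1..d} - R) (x, y))) \<partial>Pi\<^sub>M ({1..d} - R) nu)
      = (\<integral>\<^sup>+u. (\<integral>\<^sup>+y. ennreal (p (merge R ({1..d} - R) (x, y(s := u)))) \<partial>Pi\<^sub>M ({1..d} - R') nu) \<partial>nu s)"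
    using nu.product_nn_integral_insert_rev[OF fin sn meas] unfolding VR[symmetric] .
  also have "\<dots> = (\<integral>\<^sup>+u. ennreal (\<Prod>k\<in>R. factor k x) * ennreal (factor s (x(s := u))) \<partial>nu s)"
  proof (rule nn_integral_cong_AE, use AE_supp_int[OF sV(1)] in eventually_elim)
    case (elim u)
    have "(\<integral>\<^sup>+y. ennreal (p (merge R' ({1..d} - R') (x(s := u), y))) \<partial>Pi\<^sub>M ({1..d} - R') nu)
        = ennreal (\<Prod>k\<in>R'. factor k (x(s := u)))"
      using Suc.hyps(1)[OF card R' xs[OF elim]] .
    also have "(\<Prod>k\<in>R'. factor k (x(s := u))) = factor s (x(s := u)) * (\<Prod>k\<in>R. factor k x)"
      using sV RV by (simp add: R'_def factor_R finite_subset)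
    finally show ?case unfolding mrg using pos by (simp add: ennreal_mult'' mult.commute del: fun_upd_apply)
  qed
  also have "\<dots> = ennreal (\<Prod>k\<in>R. factor k x) * (\<integral>\<^sup>+u. ennreal (factor s (x(s := u))) \<partial>nu s)"
    by (rule nn_integral_cmult) (use factor_nn_integral(1)[OF sV(1) resx] in measurable)
  also have "\<dots> = ennreal (\<Prod>k\<in>R. factor k x)" by (simp add: factor_nn_integral(2)[OF sV(1) resx])
  finally show ?case .
qed

text \<open>\<open>marg_dens\<close> is a Bochner integral and \<open>p\<close> is known to be
  positive only on the product-support interior; as that is almost everywhere, the value of the
  nonnegative integral carries over.\<close>

lemma marg_dens_eq:
  assumes R: "parent_closed R" and x: "x \<in> prod_int C X R"
  shows "marg_dens d C X p R x = (\<Prod>k\<in>R. factor k x)"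
proof -
  have RV: "R \<subseteq> {1..d}" using R by (simp add: parent_closed_def)
  have "AE y in Pi\<^sub>M ({1..d} - R) nu. 0 \<le> p (merge R ({1..d} - R) (x, y))"
    using AE_prod_int[of "{1..d} - R", OF Diff_subset]
  proof eventually_elim
    case (elim y)
    have "merge R ({1..d} - R) (x, y) \<in> prod_int C X {1..d}"
      using x elim RV by (auto simp: merge_def prod_int_def PiE_iff extensional_def)
    then show ?case using p_pos less_imp_le by blast
  qed
  then have "marg_dens d C X p R x =
      enn2real (\<integral>\<^sup>+y. ennreal (p (merge R ({1..d} - R) (x, y))) \<partial>Pi\<^sub>M ({1..d} - R) nu)"
    unfolding marg_dens_def PiM_ref[OF Diff_subset]
    by (intro integral_eq_nn_integral merge_section_measurable RV prod_int_space x)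
  also have "\<dots> = (\<Prod>k\<in>R. factor k x)"
    unfolding nn_integral_marginal[OF R x]
    using x RV by (intro enn2real_ennreal prod_nonneg ballI less_imp_le factor_pos) (auto simp: prod_int_def)
  finally show ?thesis .
qed

lemma sets_marg_law: "R \<subseteq> {1..d} \<Longrightarrow> sets (marg_law C X P R) = sets (Pi\<^sub>M R nu)"
  by (simp add: marg_law_def PiM_ref)

lemma space_marg_law: "R \<subseteq> {1..d} \<Longrightarrow> space (marg_law C X P R) = space (Pi\<^sub>M R nu)"
  by (simp add: marg_law_def PiM_ref)

lemma prob_space_marg_law:
  assumes "R \<subseteq> {1..d}"
  shows "prob_space (marg_law C X P R)"
proof -
  interpret prob_space P by (rule law_prob)
  show ?thesis unfolding marg_law_def
    by (rule prob_space_distr) (unfold law_density measurable_density_eq1, rule measurable_restrict_subset[OF assms])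
qed

text \<open>The marginal law has a density with respect to the reference measure that is positive
  almost everywhere, so both have the same null sets.\<close>

lemma AE_marg_law_iff:
  assumes R: "parent_closed R"
  shows "(AE x in marg_law C X P R. Q x) \<longleftrightarrow> (AE x in Pi\<^sub>M R nu. Q x)"
proof -
  have RV: "R \<subseteq> {1..d}" using R by (simp add: parent_closed_def)
  \<comment> \<open>Chosen instead of the product of factors because it is measurable on the whole
    product space; the product formula is needed only to see that \<open>m\<close> is positive on
    the interior.\<close>
  define m where "m x = (\<integral>\<^sup>+y. ennreal (p (merge R ({1..d} - R) (x, y))) \<partial>Pi\<^sub>M ({1..d} - R) nu)" for x
  have un: "R \<union> ({1..d} - R) = {1..d}" using RV by blast
  have mg: "merge R ({1..d} - R) \<in> measurable (Pi\<^sub>M R nu \<Otimes>\<^sub>M Pi\<^sub>M ({1..d} - R) nu) (Pi\<^sub>M {1..d} nu)"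
    using measurable_merge[of R "{1..d} - R" nu] unfolding un .
  note [measurable] = mg p_measurable_nu
  have fin: "finite R" "finite ({1..d} - R)" using RV finite_subset by auto
  interpret J: finite_product_sigma_finite nu "{1..d} - R" by standard (rule fin)
  have m_meas[measurable]: "m \<in> borel_measurable (Pi\<^sub>M R nu)"
    unfolding m_def by measurable
  have rs[measurable]: "(\<lambda>x. restrict x R) \<in> measurable (Pi\<^sub>M {1..d} nu) (Pi\<^sub>M R nu)"
    by (rule measurable_restrict_subset[OF RV])
  have "marg_law C X P R = density (Pi\<^sub>M R nu) m"
  proof (rule measure_eqI)
    fix A assume "A \<in> sets (marg_law C X P R)"
    then have A[measurable]: "A \<in> sets (Pi\<^sub>M R nu)" by (simp add: sets_marg_law[OF RV])
    let ?g = "\<lambda>x. ennreal (p x) * indicator A (restrict x R)"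
    have "emeasure (marg_law C X P R) A = emeasure P ((\<lambda>x. restrict x R) -` A \<inter> space P)"
      unfolding marg_law_def PiM_ref[OF RV]
      by (rule emeasure_distr)
        (unfold law_density PiM_ref[OF subset_refl] measurable_density_eq1, rule rs, rule A)
    also have "\<dots> = (\<integral>\<^sup>+x. ennreal (p x) * indicator ((\<lambda>x. restrict x R) -` A \<inter> space P) x \<partial>Pi\<^sub>M {1..d} nu)"
      unfolding law_density PiM_ref[OF subset_refl] space_density
      by (rule emeasure_density[OF measurable_compose[OF p_measurable_nu measurable_ennreal] measurable_sets[OF rs A]])
    also have "\<dots> = (\<integral>\<^sup>+x. ?g x \<partial>Pi\<^sub>M {1..d} nu)"
      by (rule nn_integral_cong) (auto simp: law_density PiM_ref indicator_def)
    also have "\<dots> = (\<integral>\<^sup>+x. (\<integral>\<^sup>+y. ?g (merge R ({1..d} - R) (x, y)) \<partial>Pi\<^sub>M ({1..d} - R) nu) \<partial>Pi\<^sub>M R nu)"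
    proof -
      have "?g \<in> borel_measurable (Pi\<^sub>M {1..d} nu)"
        using measurable_compose[OF p_measurable_nu measurable_ennreal]
          measurable_compose[OF rs borel_measurable_indicator[OF A]]
        by (rule borel_measurable_times_ennreal)
      then show ?thesis
        using nu.product_nn_integral_fold[of R "{1..d} - R" ?g] fin unfolding un by blast
    qed
    also have "\<dots> = (\<integral>\<^sup>+x. m x * indicator A x \<partial>Pi\<^sub>M R nu)"
    proof (rule nn_integral_cong)
      fix x assume x: "x \<in> space (Pi\<^sub>M R nu)"
      have "restrict (merge R ({1..d} - R) (x, y)) R = x" for y
        using x by (auto simp: merge_def space_PiM PiE_iff extensional_def fun_eq_iff)
      moreover have "(\<lambda>y. ennreal (p (merge R ({1..d} - R) (x, y)))) \<in> borel_measurable (Pi\<^sub>M ({1..d} - R) nu)"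
        using merge_section_measurable[OF RV x] by measurable
      ultimately show "(\<integral>\<^sup>+y. ?g (merge R ({1..d} - R) (x, y)) \<partial>Pi\<^sub>M ({1..d} - R) nu) = m x * indicator A x"
        by (simp add: m_def nn_integral_multc)
    qed
    also have "\<dots> = emeasure (density (Pi\<^sub>M R nu) m) A"
      by (rule emeasure_density[symmetric]) measurable
    finally show "emeasure (marg_law C X P R) A = emeasure (density (Pi\<^sub>M R nu) m) A" .
  qed (simp add: sets_marg_law[OF RV])
  then have "(AE x in marg_law C X P R. Q x) \<longleftrightarrow> (AE x in Pi\<^sub>M R nu. 0 < m x \<longrightarrow> Q x)"
    by (simp only: AE_density[OF m_meas])
  moreover have pos: "AE x in Pi\<^sub>M R nu. 0 < m x"
    using AE_prod_int[OF RV]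
  proof eventually_elim
    case (elim x)
    then show ?case unfolding m_def nn_integral_marginal[OF R elim]
      using RV by (auto intro!: prod_pos factor_pos simp: prod_int_def)
  qed
  moreover have "(AE x in Pi\<^sub>M R nu. 0 < m x \<longrightarrow> Q x) \<longleftrightarrow> (AE x in Pi\<^sub>M R nu. Q x)"
    using pos by (intro eventually_subst) (auto elim: eventually_mono)
  ultimately show ?thesis by blast
qed

end

section \<open>Curvature of the marginal log-densities\<close>

context regular_glm_dag
begin

section \<open>Regularity and nonvanishing of the natural parameters\<close>

lemma linear_domain_supp_int: "j \<in> {1..d} \<Longrightarrow> linear_domain (j \<in> C) (supp_int C X j)"
  using continuous_var[of j] count_var[of j]
  by (auto simp: linear_domain_def supp_int_def continuous_support_def is_interval_convex
      intro: count_support_consecutive convex_interior)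

text \<open>These are the sets on which \<open>eta_C2\<close> provides regularity: the count parents
  are frozen at \<open>c\<close> and only continuous parents vary.\<close>

definition slice :: "nat \<Rightarrow> (nat \<Rightarrow> real) \<Rightarrow> (nat \<Rightarrow> real) set" where
  "slice k c = {z \<in> prod_int C X (Pa E k). \<forall>l\<in>Pa E k \<inter> C. z l = c l}"

lemma eta_C2_slice:
  "k \<in> {1..d} \<Longrightarrow> Pa E k \<noteq> {} \<Longrightarrow> C2_coords (Pa E k - C) (\<eta> k) (slice k c)"
  unfolding slice_def by (rule eta_C2)

lemma prod_int_upd:
  "x \<in> prod_int C X R \<Longrightarrow> j \<in> R \<Longrightarrow> s \<in> supp_int C X j \<Longrightarrow> x(j := s) \<in> prod_int C X R"
  by (auto simp: prod_int_def PiE_iff extensional_def)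

lemma parent_in: "j \<in> Pa E k \<Longrightarrow> k \<in> {1..d} \<and> j \<in> {1..d} \<and> Pa E k \<noteq> {} \<and> j \<noteq> k"
  using edge_in[of j k] not_own_parent[of k] by (auto simp: Pa_def)

lemma eta_smooth:
  assumes j: "j \<in> Pa E k" and z: "z \<in> prod_int C X (Pa E k)"
  shows "smooth_on (j \<in> C) (supp_int C X j) (\<lambda>s. \<eta> k (z(j := s)))"
proof (cases "j \<in> C")
  case False
  have sl: "z(j := s) \<in> slice k z" if "s \<in> supp_int C X j" for s
    using prod_int_upd[OF z j that] False by (auto simp: slice_def)
  have "has_partial_on j (\<eta> k) (slice k z)" "has_partial_on j (partial j (\<eta> k)) (slice k z)"
    using eta_C2_slice[of k z] parent_in[OF j] j False by (auto simp: C2_coords_def)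
  then have "(\<lambda>t. \<eta> k ((z(j := s))(j := t))) differentiable at ((z(j := s)) j)"
      "(\<lambda>t. partial j (\<eta> k) ((z(j := s))(j := t))) differentiable at ((z(j := s)) j)"
    if "s \<in> supp_int C X j" for s
    using sl[OF that] unfolding has_partial_on_def by blast+
  moreover have "deriv (\<lambda>s. \<eta> k (z(j := s))) = (\<lambda>t. partial j (\<eta> k) (z(j := t)))"
    by (simp add: partial_def fun_eq_iff)
  ultimately show ?thesis by (simp add: smooth_on_def twice_diff_def)
qed (simp add: smooth_on_def)

text \<open>Shifting the count parent \<open>j\<close> maps one slice into another, and
  \<open>\<eta> k\<close> is continuous on each of them.\<close>

lemma eta_shift_continuous:
  assumes j: "j \<in> Pa E k" "j \<in> C" and h: "z j + h \<in> supp_int C X j"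
  shows "continuous_on (slice k z) (\<lambda>y. \<eta> k (y(j := y j + h)))"
proof (rule continuous_on_compose2[where g = "\<eta> k" and t = "slice k (z(j := z j + h))"])
  show "continuous_on (slice k (z(j := z j + h))) (\<eta> k)"
    using eta_C2_slice[of k] parent_in[OF j(1)] by (auto simp: C2_coords_def)
  show "continuous_on (slice k z) (\<lambda>y. y(j := y j + h))"
  proof (rule continuous_on_coordinatewise_then_product)
    show "continuous_on (slice k z) (\<lambda>y. (y(j := y j + h)) i)" for i
      using continuous_on_subset[OF continuous_on_product_coordinates subset_UNIV]
      by (cases "i = j") (auto intro!: continuous_intros)
  qed
  show "(\<lambda>y. y(j := y j + h)) ` slice k z \<subseteq> slice k (z(j := z j + h))"
    using h j by (auto simp: slice_def intro!: prod_int_upd)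
qed

text \<open>Continuity is in the continuous parents, with the count parents frozen; it lets a
  nonzero value at \<open>z\<close> spread to a box.\<close>

lemma D_eta_continuous:
  assumes j: "j \<in> Pa E k" and z: "z \<in> prod_int C X (Pa E k)"
  shows "z j \<in> adm C X 1 j \<Longrightarrow> continuous_on (slice k z) (D1 C j (\<eta> k))"
    and "z j \<in> adm C X 2 j \<Longrightarrow> continuous_on (slice k z) (D2 C j (\<eta> k))"
proof -
  have c0: "continuous_on (slice k z) (\<eta> k)"
    using eta_C2_slice[of k] parent_in[OF j] by (auto simp: C2_coords_def)
  have "(z j \<in> adm C X 1 j \<longrightarrow> continuous_on (slice k z) (D1 C j (\<eta> k)))
    \<and> (z j \<in> adm C X 2 j \<longrightarrow> continuous_on (slice k z) (D2 C j (\<eta> k)))"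
  proof (cases "j \<in> C")
    case True
    show ?thesis
      using True c0 eta_shift_continuous[OF j True, of z]
      by (auto simp: D1_def[abs_def] D2_def[abs_def] adm_eq steps_1_iff steps_2_iff
          simp del: One_nat_def intro!: continuous_intros)
  next
    case False
    then show ?thesis
      using eta_C2_slice[of k z] parent_in[OF j] j
      by (auto simp: C2_coords_def D1_def[abs_def] D2_def[abs_def])
  qed
  then show "z j \<in> adm C X 1 j \<Longrightarrow> continuous_on (slice k z) (D1 C j (\<eta> k))"
    and "z j \<in> adm C X 2 j \<Longrightarrow> continuous_on (slice k z) (D2 C j (\<eta> k))" by auto
qed

text \<open>Continuous parents range over open sets taken from a basic neighbourhood in the product
  topology, count parents over singletons. Singletons have positive counting measure, so no side of
  the box is null.\<close>

lemma nonzero_box: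
  assumes cont: "continuous_on (slice k z) \<Phi>" and z: "z \<in> prod_int C X (Pa E k)" and nz: "\<Phi> z \<noteq> (0::real)"
  obtains A where "\<And>l. l \<in> Pa E k \<Longrightarrow> A l \<in> sets (nu l) \<and> emeasure (nu l) (A l) \<noteq> 0 \<and> A l \<subseteq> supp_int C X l"
    and "\<And>l y. l \<in> Pa E k \<Longrightarrow> l \<in> C \<Longrightarrow> y \<in> A l \<Longrightarrow> y = z l"
    and "\<And>y. y \<in> Pi\<^sub>E (Pa E k) A \<Longrightarrow> \<Phi> y \<noteq> 0"
proof -
  have "openin (top_of_set (slice k z)) (slice k z \<inter> \<Phi> -` (- {0}))"
    using cont by (rule continuous_openin_preimage_gen) auto
  then obtain T where T: "open T" "slice k z \<inter> \<Phi> -` (- {0}) = slice k z \<inter> T"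
    by (auto simp: openin_open)
  have "z \<in> T" using T(2) z nz by (auto simp: slice_def)
  then obtain B where B: "z \<in> Pi\<^sub>E UNIV B" "\<And>i. open (B i)" "Pi\<^sub>E UNIV B \<subseteq> T"
    using product_topology_open_contains_basis[of "\<lambda>_. euclidean" UNIV T z] T(1)
    by (auto simp: open_fun_def)
  define A where "A l = (if l \<in> C then {z l} else B l \<inter> supp_int C X l)" for l
  have zs: "z l \<in> supp_int C X l" if "l \<in> Pa E k" for l
    using z that by (auto simp: prod_int_def)
  show ?thesis
  proof
    fix l assume l: "l \<in> Pa E k"
    then have lV: "l \<in> {1..d}" using parent_in by blast
    show "A l \<in> sets (nu l) \<and> emeasure (nu l) (A l) \<noteq> 0 \<and> A l \<subseteq> supp_int C X l"
    proof (cases "l \<in> C")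
      case True
      then have "z l \<in> X l" using zs[OF l] by (simp add: supp_int_def)
      then show ?thesis using True zs[OF l] emeasure_nu_singleton[OF lV True]
        by (simp add: A_def nu_count[OF lV True])
    next
      case False
      have "z l \<in> B l \<inter> supp_int C X l" using B(1) zs[OF l] by auto
      then show ?thesis
        using False emeasure_nu_pos[OF lV B(2)[of l]] open_Int_supp_sets[OF lV B(2)[of l]]
        by (auto simp: A_def)
    qed
  next
    fix y assume y: "y \<in> Pi\<^sub>E (Pa E k) A"
    have "y \<in> slice k z"
      using y zs by (auto simp: slice_def prod_int_def A_def PiE_iff split: if_splits)
    moreover have "y i \<in> B i" for i
    proof (cases "i \<in> Pa E k")
      case True
      then show ?thesis using y B(1) by (auto simp: A_def PiE_iff split: if_splits)
    next
      case False
      \<comment> \<open>The topology is that of functions on all naturals; outside the parents both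
        points are \<open>undefined\<close> by extensionality.\<close>
      then have "y i = z i" using y z by (auto simp: prod_int_def PiE_iff extensional_def)
      then show ?thesis using B(1) by auto
    qed
    ultimately have "y \<in> slice k z \<inter> T" using B(3) by auto
    then show "\<Phi> y \<noteq> 0" using T(2) by blast
  qed (auto simp: A_def)
qed

lemma ln_factor: "k \<in> {1..d} \<Longrightarrow> x k \<in> supp_int C X k \<Longrightarrow> ln (factor k x) = (if Pa E k = {} then ln (q k (x k))
  else ln (b k (x k)) + (x k * \<eta> k (restrict x (Pa E k)) - log_partition (nu k) (b k) (\<eta> k (restrict x (Pa E k)))))"
  using b_pos[of k "x k"] by (cases "Pa E k = {}") (simp_all add: factor_eq ln_mult less_imp_neq[THEN not_sym] del: atLeastAtMost_iff)

lemma log_partition_smooth: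
  "k \<in> {1..d} \<Longrightarrow> Pa E k \<noteq> {} \<Longrightarrow>
    twice_diff (interior (natural_domain (nu k) (b k))) (log_partition (nu k) (b k))"
  by (rule log_partition_twice_diff[OF id_measurable_nu AE_b_pos nu_space_pos])

text \<open>The substantial case is a parent coordinate, where the log-partition function is
  composed with the natural parameter: \<open>eta_range\<close> keeps the argument in the interior
  of the natural domain. In its own coordinate a non-source factor adds only a linear term to
  \<open>ln (b k s)\<close>.\<close>

lemma ln_factor_smooth:
  assumes k: "k \<in> {1..d}" "x k \<in> supp_int C X k" and x: "restrict x (Pa E k) \<in> prod_int C X (Pa E k)"
    and j: "j \<in> {1..d}"
  shows "smooth_on (j \<in> C) (supp_int C X j) (\<lambda>s. ln (factor k (x(j := s))))"
proof -
  note dom = linear_domain_supp_int[OF j]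
  consider "j = k" "Pa E k = {}" | "j = k" "Pa E k \<noteq> {}" | "j \<in> Pa E k" | "j \<noteq> k" "j \<notin> Pa E k" by blast
  then show ?thesis
  proof cases
    case 1
    have "smooth_on (j \<in> C) (supp_int C X j) (\<lambda>s. ln (q k s))"
      using q_C2[of k] 1 k by (auto simp: smooth_on_def twice_diff_def C2_real_def supp_int_def)
    then show ?thesis
      by (rule smooth_on_cong[OF dom, rotated]) (use k 1 in \<open>simp add: ln_factor\<close>)
  next
    case 2
    have "smooth_on (j \<in> C) (supp_int C X j) (\<lambda>s. ln (b k s))"
      using b_C2[of k] 2 k by (auto simp: smooth_on_def twice_diff_def C2_real_def supp_int_def)
    \<comment> \<open>The padding \<open>0 * 0\<close> puts the zero function in the second slot of
      the affine combination.\<close>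
    then have "smooth_on (j \<in> C) (supp_int C X j) (\<lambda>s. ln (b k s) + 0 * 0 + \<eta> k (restrict x (Pa E k)) * s
        + (- log_partition (nu k) (b k) (\<eta> k (restrict x (Pa E k)))))"
      by (intro smooth_on_affine_comb[OF dom] smooth_on_const[OF dom])
    then show ?thesis
    proof (rule smooth_on_cong[OF dom, rotated])
      fix s assume s: "s \<in> supp_int C X j"
      have "restrict (x(k := s)) (Pa E k) = restrict x (Pa E k)"
        using not_own_parent by (auto simp: restrict_def)
      then show "ln (factor k (x(j := s))) = ln (b k s) + 0 * 0 + \<eta> k (restrict x (Pa E k)) * s
        + (- log_partition (nu k) (b k) (\<eta> k (restrict x (Pa E k))))"
        using k 2 s by (simp add: ln_factor mult.commute)
    qed
  next
    case 3
    let ?e = "\<lambda>s. \<eta> k ((restrict x (Pa E k))(j := s))"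
    have Pa: "Pa E k \<noteq> {}" "j \<noteq> k" using parent_in[OF 3] by auto
    have e: "smooth_on (j \<in> C) (supp_int C X j) ?e" by (rule eta_smooth[OF 3 x])
    have range: "?e ` supp_int C X j \<subseteq> interior (natural_domain (nu k) (b k))"
      using eta_in_domain[OF k(1) Pa(1) prod_int_upd[OF x 3]] by blast
    have "smooth_on (j \<in> C) (supp_int C X j) (\<lambda>s. log_partition (nu k) (b k) (?e s))"
      using e dom twice_diff_compose[OF _ log_partition_smooth[OF k(1) Pa(1)] _ range]
      by (cases "j \<in> C") (auto simp: smooth_on_def linear_domain_def)
    then have "smooth_on (j \<in> C) (supp_int C X j) (\<lambda>s. (\<lambda>s. x k * ?e s) s
        + (- 1) * log_partition (nu k) (b k) (?e s) + 0 * s + ln (b k (x k)))"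
    proof (rule smooth_on_affine_comb[OF dom, rotated])
      have "smooth_on (j \<in> C) (supp_int C X j) (\<lambda>s. 0 + x k * ?e s + 0 * s + 0)"
        by (intro smooth_on_affine_comb[OF dom] smooth_on_const[OF dom] e)
      then show "smooth_on (j \<in> C) (supp_int C X j) (\<lambda>s. x k * ?e s)" by simp
    qed
    then show ?thesis
    proof (rule smooth_on_cong[OF dom, rotated])
      fix s assume s: "s \<in> supp_int C X j"
      have "restrict (x(j := s)) (Pa E k) = (restrict x (Pa E k))(j := s)"
        using 3 by (auto simp: restrict_def)
      then show "ln (factor k (x(j := s))) = x k * ?e s
          + (- 1) * log_partition (nu k) (b k) (?e s) + 0 * s + ln (b k (x k))"
        using k Pa by (simp add: ln_factor)
    qed
  next
    case 4
    have "factor k (x(j := s)) = factor k x" for s by (rule cond_dens_cong) (use 4 in auto)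
    then show ?thesis by (simp add: smooth_on_const[OF dom])
  qed
qed

section \<open>Differences of marginal log-densities\<close>

abbreviation log_marg :: "nat set \<Rightarrow> (nat \<Rightarrow> real) \<Rightarrow> real" where
  "log_marg R \<equiv> \<lambda>y. ln (marg_dens d C X p R y)"

lemma parent_closedD: "parent_closed R \<Longrightarrow> k \<in> R \<Longrightarrow> k \<in> {1..d} \<and> Pa E k \<subseteq> R"
  by (auto simp: parent_closed_def)

lemma log_marg_eq:
  assumes R: "parent_closed R" and x: "x \<in> prod_int C X R"
  shows "log_marg R x = (\<Sum>k\<in>R. ln (factor k x))"
proof -
  have "finite R" using R finite_subset by (auto simp: parent_closed_def)
  moreover have "0 < factor k x" if "k \<in> R" for k
    using x parent_closedD[OF R that] that by (intro factor_pos) (auto simp: prod_int_def)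
  ultimately show ?thesis
    unfolding marg_dens_eq[OF R x] by (intro ln_prod) (auto simp: less_imp_neq[THEN not_sym])
qed

text \<open>Licenses splitting \<open>deriv\<close> when one log-marginal is written as another plus
  a multiple of a natural parameter.\<close>

lemma log_marg_smooth:
  assumes R: "parent_closed R" and x: "x \<in> prod_int C X R" and j: "j \<in> R"
  shows "smooth_on (j \<in> C) (supp_int C X j) (\<lambda>s. log_marg R (x(j := s)))"
proof -
  have jV: "j \<in> {1..d}" using parent_closedD[OF R j] by blast
  have "smooth_on (j \<in> C) (supp_int C X j) (\<lambda>s. \<Sum>k\<in>R. ln (factor k (x(j := s))))"
  proof (intro smooth_on_sum linear_domain_supp_int jV ln_factor_smooth)
    fix k assume "k \<in> R"
    then show "k \<in> {1..d}" "x k \<in> supp_int C X k" "restrict x (Pa E k) \<in> prod_int C X (Pa E k)"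
      using parent_closedD[OF R] x prod_int_restrict[OF x] by (auto simp: prod_int_def)
  qed
  then show ?thesis
    by (rule smooth_on_cong[OF linear_domain_supp_int[OF jV], rotated])
       (rule log_marg_eq[OF R prod_int_upd[OF x j]])
qed

text \<open>If no child of \<open>i\<close> in \<open>R\<close> is \<open>j\<close> or a child of \<open>j\<close>, then \<open>x i\<close> and \<open>x j\<close> interact only through
  the factor of \<open>i\<close>, so that moving \<open>x i\<close> isolates the natural parameter of \<open>i\<close>.\<close>

lemma log_marg_difference:
  assumes R: "parent_closed R" and x: "x \<in> prod_int C X R" and ij: "i \<in> R" "j \<in> R" "i \<noteq> j"
    and last: "\<And>k. k \<in> R \<Longrightarrow> i \<in> Pa E k \<Longrightarrow> k \<noteq> j \<and> j \<notin> Pa E k"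
    and a: "a \<in> supp_int C X i" "a' \<in> supp_int C X i"
  shows "\<exists>\<gamma>. \<forall>s\<in>supp_int C X j. log_marg R (x(i := a, j := s)) = log_marg R (x(i := a', j := s))
    + (if j \<in> Pa E i then (a - a') * \<eta> i ((restrict x (Pa E i))(j := s)) else 0) + \<gamma>"
proof -
  let ?u = "\<lambda>a s. x(i := a, j := s)"
  let ?e = "\<lambda>k s. if k = i \<and> j \<in> Pa E i then (a - a') * \<eta> i ((restrict x (Pa E i))(j := s)) else 0"
  have iV: "i \<in> {1..d}" using parent_closedD[OF R ij(1)] by blast
  \<comment> \<open>Each factor is compared separately; what matters is that \<gamma> does not
    depend on \<open>s\<close>.\<close>
  have "\<exists>\<gamma>. \<forall>s\<in>supp_int C X j. ln (factor k (?u a s)) = ln (factor k (?u a' s)) + ?e k s + \<gamma>" if k: "k \<in> R" for k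
  proof (cases "k = i \<and> j \<in> Pa E i")
    case True
    have r: "restrict (?u c s) (Pa E i) = (restrict x (Pa E i))(j := s)" for c s
      using True not_own_parent[of i] by (auto simp: restrict_def fun_eq_iff)
    \<comment> \<open>The log-partition term depends on the parents of \<open>i\<close> only and
      cancels; the base function leaves a constant.\<close>
    show ?thesis
      using True a ij iV parent_in[of j i]
      by (intro exI[of _ "ln (b i a) - ln (b i a')"]) (auto simp: ln_factor r algebra_simps simp del: atLeastAtMost_iff)
  next
    case False
    show ?thesis
    proof (cases "k = i \<or> i \<in> Pa E k")
      case True
      \<comment> \<open>This factor may change with \<open>x i\<close>, but \<open>last\<close>
        keeps \<open>x j\<close> out of it, so the change is constant in \<open>s\<close>.\<close>
      then have "k \<noteq> j" "j \<notin> Pa E k" using False last[OF k] ij by auto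
      then have "factor k (?u c s) = factor k (x(i := c))" for c s by (intro cond_dens_cong) auto
      then show ?thesis
        using False by (intro exI[of _ "ln (factor k (x(i := a))) - ln (factor k (x(i := a')))"]) auto
    next
      case nofi: False
      then have "factor k (?u a s) = factor k (?u a' s)" for s by (intro cond_dens_cong) auto
      then show ?thesis using False by (intro exI[of _ 0]) auto
    qed
  qed
  then obtain g where g: "\<And>k s. k \<in> R \<Longrightarrow> s \<in> supp_int C X j \<Longrightarrow>
      ln (factor k (?u a s)) = ln (factor k (?u a' s)) + ?e k s + g k" by metis
  have fin: "finite R" using R finite_subset by (auto simp: parent_closed_def)
  have "log_marg R (?u a s) = log_marg R (?u a' s) + (if j \<in> Pa E i then (a - a') * \<eta> i ((restrict x (Pa E i))(j := s)) else 0) + (\<Sum>k\<in>R. g k)"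
    if s: "s \<in> supp_int C X j" for s
  proof -
    have u: "?u c s \<in> prod_int C X R" if "c \<in> supp_int C X i" for c
      using that s x ij by (intro prod_int_upd)
    have "(\<Sum>k\<in>R. ?e k s) = ?e i s"
      using fin ij(1) by (subst sum.remove[of R i]) auto
    then show ?thesis
      unfolding log_marg_eq[OF R u[OF a(1)]] log_marg_eq[OF R u[OF a(2)]]
      using g[OF _ s] by (simp add: sum.distrib cong: sum.cong)
  qed
  then show ?thesis by blast
qed

text \<open>The curvature itself may contain complicated log-partition terms of other children of
  \<open>j\<close>; they are identical at both values of \<open>x i\<close> and disappear from the
  difference, leaving a term linear in \<open>a - a'\<close>.\<close>

lemma
  assumes R: "parent_closed R" and x: "x \<in> prod_int C X R" and ij: "i \<in> R" "j \<in> R" "i \<noteq> j"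
    and last: "\<And>k. k \<in> R \<Longrightarrow> i \<in> Pa E k \<Longrightarrow> k \<noteq> j \<and> j \<notin> Pa E k"
    and a: "a \<in> supp_int C X i" "a' \<in> supp_int C X i"
  shows D1_log_marg_difference: "x j \<in> adm C X 1 j \<Longrightarrow> D1 C j (log_marg R) (x(i := a)) = D1 C j (log_marg R) (x(i := a'))
      + (if j \<in> Pa E i then (a - a') * D1 C j (\<eta> i) (restrict x (Pa E i)) else 0)"
    and D2_log_marg_difference: "x j \<in> adm C X 2 j \<Longrightarrow> D2 C j (log_marg R) (x(i := a)) = D2 C j (log_marg R) (x(i := a'))
      + (if j \<in> Pa E i then (a - a') * D2 C j (\<eta> i) (restrict x (Pa E i)) else 0)"
proof -
  let ?c = "j \<in> C" and ?U = "supp_int C X j"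
  let ?h = "\<lambda>s. if j \<in> Pa E i then \<eta> i ((restrict x (Pa E i))(j := s)) else 0"
  have dom: "linear_domain ?c ?U" using parent_closedD[OF R ij(2)] by (blast intro: linear_domain_supp_int)
  have g: "smooth_on ?c ?U (\<lambda>s. log_marg R (x(i := a', j := s)))"
    by (rule log_marg_smooth[OF R prod_int_upd[OF x ij(1) a(2)] ij(2)])
  have h: "smooth_on ?c ?U ?h"
    using eta_smooth[of j i, OF _ prod_int_restrict[OF x]] parent_closedD[OF R ij(1)] smooth_on_const[OF dom]
    by (cases "j \<in> Pa E i") auto
  have "\<exists>\<gamma>. \<forall>s\<in>?U. log_marg R (x(i := a, j := s)) = log_marg R (x(i := a', j := s))
      + (a - a') * ?h s + 0 * s + \<gamma>"
    using log_marg_difference[OF R x ij last a] by (cases "j \<in> Pa E i") simp_all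
  then obtain \<gamma> where \<gamma>: "\<And>s. s \<in> ?U \<Longrightarrow> log_marg R (x(i := a, j := s)) = log_marg R (x(i := a', j := s))
      + (a - a') * ?h s + 0 * s + \<gamma>" by blast
  have 0: "d1 ?c (\<lambda>s. 0) t = 0" "d2 ?c (\<lambda>s. 0) t = 0" for t by (auto simp: d1_def d2_def)
  note comb = d1_affine_comb[OF dom g h \<gamma>] d2_affine_comb[OF dom g h \<gamma>]
  show "x j \<in> adm C X 1 j \<Longrightarrow> D1 C j (log_marg R) (x(i := a)) = D1 C j (log_marg R) (x(i := a'))
      + (if j \<in> Pa E i then (a - a') * D1 C j (\<eta> i) (restrict x (Pa E i)) else 0)"
    using comb(1)[of "x j"] ij(3) by (cases "j \<in> Pa E i") (simp_all add: D1_eq adm_eq 0)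
  show "x j \<in> adm C X 2 j \<Longrightarrow> D2 C j (log_marg R) (x(i := a)) = D2 C j (log_marg R) (x(i := a'))
      + (if j \<in> Pa E i then (a - a') * D2 C j (\<eta> i) (restrict x (Pa E i)) else 0)"
    using comb(2)[of "x j"] ij(3) by (cases "j \<in> Pa E i") (simp_all add: D2_eq adm_eq 0)
qed

text \<open>With \<open>x i\<close> as base point, the difference formula shows that the first
  difference in \<open>x j\<close> is affine in \<open>x i\<close>; its slope is what
  \<open>D1 C i\<close> extracts.\<close>

lemma D1_D1_log_marg:
  assumes R: "parent_closed R" and x: "x \<in> prod_int C X R" and ij: "i \<in> R" "j \<in> R" "i \<noteq> j"
    and last: "\<And>k. k \<in> R \<Longrightarrow> i \<notin> Pa E k"
    and adm: "x i \<in> adm C X 1 i" "x j \<in> adm C X 1 j"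
  shows "D1 C i (D1 C j (log_marg R)) x = (if j \<in> Pa E i then D1 C j (\<eta> i) (restrict x (Pa E i)) else 0)"
proof -
  let ?\<beta> = "if j \<in> Pa E i then D1 C j (\<eta> i) (restrict x (Pa E i)) else 0"
  have xi: "x i \<in> supp_int C X i" using x ij by (auto simp: prod_int_def)
  have dom: "linear_domain (i \<in> C) (supp_int C X i)" using parent_closedD[OF R ij(1)] by (blast intro: linear_domain_supp_int)
  have *: "D1 C j (log_marg R) (x(i := s)) = 0 + 0 * 0 + ?\<beta> * s + (D1 C j (log_marg R) x - ?\<beta> * x i)"
    if s: "s \<in> supp_int C X i" for s
    using D1_log_marg_difference[OF R x ij _ s xi adm(2)] last by (auto simp: algebra_simps)
  have "d1 (i \<in> C) (\<lambda>s. D1 C j (log_marg R) (x(i := s))) (x i) = d1 (i \<in> C) (\<lambda>s. 0) (x i) + 0 * d1 (i \<in> C) (\<lambda>s. 0) (x i) + ?\<beta>"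
    by (rule d1_affine_comb[OF dom smooth_on_const[OF dom] smooth_on_const[OF dom] *])
       (use adm in \<open>simp_all add: adm_eq\<close>)
  also have "d1 (i \<in> C) (\<lambda>s. 0) (x i) = 0" by (simp add: d1_def)
  finally show ?thesis unfolding D1_eq[of C i "D1 C j (log_marg R)" x] by (simp del: fun_upd_apply)
qed

text \<open>The parents act on the factor of \<open>j\<close> only through a term linear in
  \<open>x j\<close> and a term free of \<open>x j\<close>; a first difference would still see the
  slope, the second does not.\<close>

lemma D2_log_marg_sink:
  assumes R: "parent_closed R" and x: "x \<in> prod_int C X R" and j: "j \<in> R"
    and sink: "\<And>k. k \<in> R \<Longrightarrow> j \<notin> Pa E k" and adm: "x j \<in> adm C X 2 j"
  shows "D2 C j (log_marg R) x = d2 (j \<in> C) (\<lambda>s. ln (if Pa E j = {} then q j s else b j s)) (x j)"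
proof -
  let ?c = "j \<in> C" and ?U = "supp_int C X j"
  let ?g = "\<lambda>s. ln (if Pa E j = {} then q j s else b j s)"
  let ?z = "restrict x (Pa E j)"
  have jV: "j \<in> {1..d}" using parent_closedD[OF R j] by blast
  note dom = linear_domain_supp_int[OF jV]
  have fin: "finite R" using R finite_subset by (auto simp: parent_closed_def)
  have g: "smooth_on ?c ?U ?g"
    using q_C2[of j] b_C2[of j] jV
    by (cases "Pa E j = {}") (auto simp: smooth_on_def twice_diff_def C2_real_def supp_int_def)
  define \<beta> where "\<beta> = (if Pa E j = {} then 0 else \<eta> j ?z)"
  define \<gamma> where "\<gamma> = (\<Sum>k\<in>R - {j}. ln (factor k x)) - (if Pa E j = {} then 0 else log_partition (nu j) (b j) (\<eta> j ?z))"
  have "log_marg R (x(j := s)) = ?g s + 0 * (\<lambda>s. 0) s + \<beta> * s + \<gamma>" if s: "s \<in> ?U" for s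
  proof -
    have "factor k (x(j := s)) = factor k x" if "k \<in> R - {j}" for k
      using sink[of k] that by (intro cond_dens_cong) auto
    then have "(\<Sum>k\<in>R - {j}. ln (factor k (x(j := s)))) = (\<Sum>k\<in>R - {j}. ln (factor k x))"
      by (intro sum.cong) auto
    moreover have "restrict (x(j := s)) (Pa E j) = ?z"
      using not_own_parent by (auto simp: restrict_def)
    ultimately show ?thesis
      unfolding log_marg_eq[OF R prod_int_upd[OF x j s]] sum.remove[OF fin j]
      using jV s by (simp add: ln_factor \<beta>_def \<gamma>_def mult.commute del: atLeastAtMost_iff)
  qed
  then have "d2 ?c (\<lambda>s. log_marg R (x(j := s))) (x j) = d2 ?c ?g (x j) + 0 * d2 ?c (\<lambda>s. 0) (x j)"
    by (rule d2_affine_comb[OF dom g smooth_on_const[OF dom]]) (use adm in \<open>simp_all add: adm_eq\<close>)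
  then show ?thesis by (simp add: D2_eq)
qed

end

section \<open>Scores\<close>

text \<open>A weak form of the Doob-Dynkin factorization: the level set of \<open>h\<close> through
  \<open>y\<close> is a preimage under \<open>Y\<close>, hence contains the whole fibre.\<close>

lemma measurable_vimage_algebra_constant:
  fixes h :: "'a \<Rightarrow> real"
  assumes h: "h \<in> borel_measurable (vimage_algebra S Y borel)"
    and xy: "x \<in> S" "y \<in> S" "Y x = Y y"
  shows "h x = h y"
proof -
  have "h -` {h y} \<inter> S \<in> sets (vimage_algebra S Y borel)"
    using measurable_sets[OF h, of "{h y}"] by simp
  then obtain B where "h -` {h y} \<inter> S = Y -` B \<inter> S"
    by (auto simp: sets_vimage_algebra2)
  then show ?thesis using xy by auto
qed

lemma (in prob_space) subalgebra_vimage: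
  assumes Y: "Y \<in> borel_measurable M"
  shows "finite_measure_subalgebra M (vimage_algebra (space M) Y borel)"
proof
  have "sets (vimage_algebra (space M) Y borel) \<subseteq> sets M"
    using measurable_sets[OF Y] by (auto simp: sets_vimage_algebra2)
  then show "subalgebra M (vimage_algebra (space M) Y borel)"
    by (simp add: subalgebra_def)
qed

text \<open>A Borel function of \<open>Y\<close> is its own conditional expectation, so the residual
  vanishes almost surely.\<close>

lemma (in prob_space) cond_variance_eq_0:
  assumes Y: "Y \<in> borel_measurable M" and f: "square_integrable M f"
    and g: "g \<in> borel_measurable borel" and fg: "AE x in M. f x = g (Y x)"
  shows "(\<integral>x. cond_variance M Y f x \<partial>M) = 0"
proof -
  define F where "F = vimage_algebra (space M) Y borel"
  interpret finite_measure_subalgebra M F unfolding F_def by (rule subalgebra_vimage[OF Y])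
  have f_int: "integrable M f" using f square_integrable_imp_integrable by (auto simp: square_integrable_def)
  note [measurable] = Y g borel_measurable_integrable[OF f_int]
  have gY: "(\<lambda>x. g (Y x)) \<in> borel_measurable F"
    unfolding F_def by (rule measurable_compose[OF measurable_vimage_algebra1 g]) auto
  have gY_int: "integrable M (\<lambda>x. g (Y x))"
    using f_int fg by (subst integrable_cong_AE[where g = f]) (auto elim: eventually_mono)
  have "AE x in M. real_cond_exp M F f x = real_cond_exp M F (\<lambda>x. g (Y x)) x"
    by (rule real_cond_exp_cong[OF fg]) measurable
  moreover have "AE x in M. real_cond_exp M F (\<lambda>x. g (Y x)) x = g (Y x)"
    by (rule real_cond_exp_F_meas[OF gY_int gY])
  ultimately have "AE x in M. (f x - real_cond_exp M F f x)\<^sup>2 = 0"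
    using fg by eventually_elim simp
  then have "AE x in M. real_cond_exp M F (\<lambda>x. (f x - real_cond_exp M F f x)\<^sup>2) x = real_cond_exp M F (\<lambda>x. 0) x"
    by (rule real_cond_exp_cong) measurable
  moreover have "AE x in M. real_cond_exp M F (\<lambda>x. 0) x = 0"
    by (rule real_cond_exp_F_meas) auto
  ultimately have "AE x in M. cond_variance M Y f x = 0"
    unfolding cond_variance_def Let_def F_def[symmetric] by eventually_elim simp
  then show ?thesis by (rule integral_eq_zero_AE)
qed

text \<open>The mean conditional variance is the mean squared residual, so \<open>f\<close> agrees
  almost surely with its conditional expectation. That version is constant on every fibre of
  \<open>Y\<close>, with no exceptional set.\<close>

lemma (in prob_space) cond_variance_eq_0_imp:
  assumes Y: "Y \<in> borel_measurable M" and f: "square_integrable M f"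
    and zero: "(\<integral>x. cond_variance M Y f x \<partial>M) = 0"
  obtains h where "AE x in M. f x = h x"
    and "\<And>x y. x \<in> space M \<Longrightarrow> y \<in> space M \<Longrightarrow> Y x = Y y \<Longrightarrow> h x = h y"
proof -
  define F where "F = vimage_algebra (space M) Y borel"
  interpret finite_measure_subalgebra M F unfolding F_def by (rule subalgebra_vimage[OF Y])
  let ?h = "real_cond_exp M F f"
  have f2: "integrable M (\<lambda>x. (f x)\<^sup>2)" and fm[measurable]: "f \<in> borel_measurable M"
    using f by (auto simp: square_integrable_def)
  have f_int: "integrable M f" by (rule square_integrable_imp_integrable[OF fm f2])
  have conv: "convex_on UNIV (\<lambda>x::real. x\<^sup>2)" by (rule convex_power2)
  \<comment> \<open>Jensen puts the conditional expectation in L2. The squared residual is then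
    integrable, so its zero integral is genuine and not the default value of a non-integrable
    function.\<close>
  have "AE x in M. (?h x)\<^sup>2 \<le> real_cond_exp M F (\<lambda>x. (f x)\<^sup>2) x"
    by (rule real_cond_exp_jensens_inequality(2)[OF f_int _ _ f2 conv]) auto
  then have le: "AE x in M. norm ((?h x)\<^sup>2) \<le> norm (real_cond_exp M F (\<lambda>x. (f x)\<^sup>2) x)"
    by eventually_elim simp
  have h2: "integrable M (\<lambda>x. (?h x)\<^sup>2)"
    by (rule Bochner_Integration.integrable_bound[OF real_cond_exp_int(1)[OF f2] _ le]) measurable
  have V_int: "integrable M (\<lambda>x. (f x - ?h x)\<^sup>2)"
  proof (rule Bochner_Integration.integrable_bound)
    show "integrable M (\<lambda>x. 2 * (f x)\<^sup>2 + 2 * (?h x)\<^sup>2)" using f2 h2 by simp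
    have "(a - b)\<^sup>2 \<le> 2 * a\<^sup>2 + 2 * b\<^sup>2" for a b :: real
      using zero_le_power2[of "a + b"] by (simp add: power2_eq_square algebra_simps)
    then show "AE x in M. norm ((f x - ?h x)\<^sup>2) \<le> norm (2 * (f x)\<^sup>2 + 2 * (?h x)\<^sup>2)" by simp
  qed measurable
  have "(\<integral>x. (f x - ?h x)\<^sup>2 \<partial>M) = 0"
    using zero real_cond_exp_int(2)[OF V_int] by (simp add: cond_variance_def Let_def F_def)
  then have "AE x in M. (f x - ?h x)\<^sup>2 = 0"
    using integral_nonneg_eq_0_iff_AE[OF V_int] by simp
  then have ae: "AE x in M. f x = ?h x" by eventually_elim simp
  have "?h \<in> borel_measurable (vimage_algebra (space M) Y borel)" unfolding F_def[symmetric] by simp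
  from that[OF ae measurable_vimage_algebra_constant[OF this]] show ?thesis .
qed

section \<open>Admissible events and their conditional laws\<close>

context regular_glm_dag
begin

lemma adm_subset: "adm C X r j \<subseteq> supp_int C X j"
  by (simp add: adm_eq steps_subset)

lemma adm_sets: "j \<in> {1..d} \<Longrightarrow> adm C X r j \<in> sets (nu j)"
  using supp_int_sets[of j] adm_subset[of r j] supp_int_subset[of j]
  by (cases "j \<in> C") (auto simp: nu_count adm_eq steps_def)

text \<open>Three consecutive support points are exactly what a second difference at the least of
  them uses.\<close>

lemma adm_nonempty:
  assumes j: "j \<in> {1..d}" and r: "r \<le> 2"
  shows "adm C X r j \<noteq> {}"
proof (cases "j \<in> C")
  case True
  then obtain a where "a \<in> X j" "a + 1 \<in> X j" "a + 2 \<in> X j"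
    using count_support_three[OF count_var[of j]] j by blast
  moreover have "s = 0 \<or> s = 1 \<or> s = 2" if "s \<le> r" for s using that r by linarith
  ultimately have "a + real s \<in> X j" if "s \<le> r" for s using that by fastforce
  then have "a \<in> adm C X r j" using True by (simp add: adm_def)
  then show ?thesis by blast
qed (use supp_int_nonempty[OF j] in \<open>simp add: adm_def supp_int_def\<close>)

lemma emeasure_adm:
  assumes j: "j \<in> {1..d}" and r: "r \<le> 2"
  shows "emeasure (nu j) (adm C X r j) \<noteq> 0"
proof (cases "j \<in> C")
  case True
  have "adm C X r j \<subseteq> X j" using adm_subset supp_int_subset by blast
  then show ?thesis
    using adm_nonempty[OF j r] by (simp add: nu_count[OF j True] emeasure_count_space_eq_0)
next
  case False
  then show ?thesis
    using emeasure_nu_pos[OF j, of UNIV] supp_int_nonempty[OF j] by (simp add: adm_def supp_int_def)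
qed

lemma emeasure_supp_int: "j \<in> {1..d} \<Longrightarrow> emeasure (nu j) (supp_int C X j) \<noteq> 0"
  using emeasure_nu_pos[of j UNIV] supp_int_nonempty[of j] by simp

lemma adm_box:
  assumes J: "l \<in> {1..d}" and r: "r \<le> 2"
  shows "(if l \<in> J then adm C X r l else supp_int C X l) \<in> sets (nu l)"
    and "emeasure (nu l) (if l \<in> J then adm C X r l else supp_int C X l) \<noteq> 0"
  using adm_sets[OF J] supp_int_sets[OF J] emeasure_adm[OF J r] emeasure_supp_int[OF J] by auto

text \<open>One family for both kinds of admissible event: \<open>r = 2\<close> with
  \<open>J = {j}\<close>, and \<open>r = 1\<close> with \<open>J = {i, j}\<close>.\<close>

definition event :: "nat \<Rightarrow> nat set \<Rightarrow> nat set \<Rightarrow> (nat \<Rightarrow> real) set" where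
  "event r J R = {x \<in> space (Pi\<^sub>M R nu). \<forall>l\<in>J. x l \<in> adm C X r l}"

text \<open>The event contains a box of positive reference measure, and null sets agree.
  Conditioning on it therefore gives a probability measure.\<close>

lemma event_positive:
  assumes R: "parent_closed R" and J: "J \<subseteq> R" and r: "r \<le> 2"
  shows "event r J R \<in> sets (marg_law C X P R)" and "emeasure (marg_law C X P R) (event r J R) \<noteq> 0"
proof -
  have RV: "R \<subseteq> {1..d}" using R by (simp add: parent_closed_def)
  have fin: "finite J" using finite_subset[OF subset_trans[OF J RV]] by simp
  have "{x \<in> space (Pi\<^sub>M R nu). x l \<in> adm C X r l} \<in> sets (Pi\<^sub>M R nu)" if "l \<in> J" for l
    using J RV that adm_sets[of l r]
    by (intro measurable_sets_Collect[OF measurable_component_singleton]) auto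
  then have "event r J R \<in> sets (Pi\<^sub>M R nu)"
    unfolding event_def using fin by (intro sets.sets_Collect_finite_All) auto
  then show ev: "event r J R \<in> sets (marg_law C X P R)" by (simp add: sets_marg_law[OF RV])
  show "emeasure (marg_law C X P R) (event r J R) \<noteq> 0"
  proof
    assume "emeasure (marg_law C X P R) (event r J R) = 0"
    then have "AE x in marg_law C X P R. x \<notin> event r J R"
      using ev by (intro AE_not_in null_setsI)
    then have ae: "AE x in Pi\<^sub>M R nu. x \<notin> event r J R" by (simp add: AE_marg_law_iff[OF R])
    let ?A = "\<lambda>l. if l \<in> J then adm C X r l else supp_int C X l"
    obtain x where x: "x \<in> Pi\<^sub>E R ?A" "x \<notin> event r J R"
    proof (rule AE_obtains_in_box[OF RV _ _ ae, of ?A])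
      show "?A l \<in> sets (nu l)" "emeasure (nu l) (?A l) \<noteq> 0" if "l \<in> R" for l
        by (rule adm_box[OF subsetD[OF RV that] r])+
    qed
    have "x \<in> prod_int C X R"
      using x(1) adm_subset by (fastforce simp: prod_int_def PiE_iff split: if_splits)
    then have "x \<in> event r J R"
      using x(1) J prod_int_space[OF RV] by (fastforce simp: event_def PiE_iff)
    with x(2) show False by blast
  qed
qed

lemma
  assumes R: "parent_closed R" and J: "J \<subseteq> R" and r: "r \<le> 2"
  shows prob_space_event: "prob_space (uniform_measure (marg_law C X P R) (event r J R))"
    and AE_event: "(AE x in uniform_measure (marg_law C X P R) (event r J R). Q x)
      \<longleftrightarrow> (AE x in Pi\<^sub>M R nu. (\<forall>l\<in>J. x l \<in> adm C X r l) \<longrightarrow> Q x)"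
proof -
  have RV: "R \<subseteq> {1..d}" using R by (simp add: parent_closed_def)
  interpret prob_space "marg_law C X P R" by (rule prob_space_marg_law[OF RV])
  note ev = event_positive[OF R J r]
  show "prob_space (uniform_measure (marg_law C X P R) (event r J R))"
    by (rule prob_space_uniform_measure[OF ev(2)]) simp
  have "(AE x in uniform_measure (marg_law C X P R) (event r J R). Q x)
      \<longleftrightarrow> (AE x in Pi\<^sub>M R nu. x \<in> event r J R \<longrightarrow> Q x)"
    using AE_uniform_measure[OF ev(2)] by (simp add: AE_marg_law_iff[OF R] less_top[symmetric])
  also have "\<dots> \<longleftrightarrow> (AE x in Pi\<^sub>M R nu. (\<forall>l\<in>J. x l \<in> adm C X r l) \<longrightarrow> Q x)"
    by (rule AE_cong) (simp add: event_def)
  finally show "(AE x in uniform_measure (marg_law C X P R) (event r J R). Q x)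
      \<longleftrightarrow> (AE x in Pi\<^sub>M R nu. (\<forall>l\<in>J. x l \<in> adm C X r l) \<longrightarrow> Q x)" .
qed

lemma adm_law_eq: "R \<subseteq> {1..d} \<Longrightarrow> adm_law C X P j R = uniform_measure (marg_law C X P R) (event 2 {j} R)"
  by (simp add: adm_law_def event_def space_marg_law)

lemma coordinate_measurable:
  assumes R: "R \<subseteq> {1..d}" and j: "j \<in> R"
  shows "(\<lambda>x. x j) \<in> borel_measurable (adm_law C X P j R)"
proof -
  have "(\<lambda>x. x j) \<in> measurable (Pi\<^sub>M R nu) (nu j)"
    by (rule measurable_component_singleton[OF j])
  then have "(\<lambda>x. x j) \<in> borel_measurable (Pi\<^sub>M R nu)"
    by (rule measurable_compose) (use R j in \<open>blast intro: id_measurable_nu\<close>)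
  then show ?thesis
    by (simp add: adm_law_eq[OF R] sets_marg_law[OF R] cong: measurable_cong_sets)
qed

lemma mixed_adm_law_eq: "R \<subseteq> {1..d} \<Longrightarrow>
    mixed_adm_law C X P i j R = uniform_measure (marg_law C X P R) (event 1 {i, j} R)"
  by (simp add: mixed_adm_law_def event_def space_marg_law)

section \<open>From graph conditions to the scores\<close>

lemma ancestral_parent_closed: "ancestral d E R \<Longrightarrow> parent_closed R"
proof (induction rule: ancestral.induct)
  case full
  then show ?case using Pa_subset by (simp add: parent_closed_def)
next
  case (remove_sink R j)
  then show ?case by (auto simp: parent_closed_def is_sink_def Ch_def induced_def Pa_def)
qed

lemma is_sink_iff: "j \<in> R \<Longrightarrow> is_sink E R j \<longleftrightarrow> (\<forall>k\<in>R. j \<notin> Pa E k)"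
  by (auto simp: is_sink_def Ch_def induced_def Pa_def)

text \<open>Extending by 0 gives a Borel function on the line: in the count case it differs from 0
  at countably many points, in the continuous case it is continuous on an open set by the
  \<open>C2_real\<close> hypotheses.\<close>

lemma sink_curv_measurable:
  assumes j: "j \<in> {1..d}"
  shows "(\<lambda>u. if u \<in> adm C X 2 j
    then d2 (j \<in> C) (\<lambda>s. ln (if Pa E j = {} then q j s else b j s)) u else 0) \<in> borel_measurable borel"
    (is "(\<lambda>u. if u \<in> ?A then ?g u else 0) \<in> _")
proof (cases "j \<in> C")
  case True
  have "countable ?A"
    by (rule countable_subset[OF subset_trans[OF adm_subset supp_int_subset] X_countable[OF j True]])
  then show ?thesis
    by (intro measurable_discrete_difference[OF measurable_const[of 0] \<open>countable ?A\<close>]) simp_all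
next
  case False
  have "open ?A" using False by (simp add: adm_def)
  moreover have "continuous_on ?A ?g"
    using False j q_C2[of j] b_C2[of j]
    by (cases "Pa E j = {}") (auto simp: adm_def d2_def[abs_def] C2_real_def)
  ultimately show ?thesis
    by (intro borel_measurable_continuous_on_if) auto
qed

lemma sink_S_score:
  assumes R: "parent_closed R" and j: "j \<in> R" and sink: "\<forall>k\<in>R. j \<notin> Pa E k"
    and L2: "square_integrable (adm_law C X P j R) (curv d C X p j R)"
  shows "S_score d C X P p j R = 0"
proof -
  have RV: "R \<subseteq> {1..d}" using R by (simp add: parent_closed_def)
  have jV: "j \<in> {1..d}" using j RV by blast
  have J: "{j} \<subseteq> R" using j by simp
  interpret prob_space "adm_law C X P j R"
    unfolding adm_law_eq[OF RV] by (rule prob_space_event[OF R J]) simp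
  note Y = coordinate_measurable[OF RV j]
  show ?thesis
    unfolding S_score_def
  proof (rule cond_variance_eq_0[OF Y L2 sink_curv_measurable[OF jV]])
    show "AE x in adm_law C X P j R. curv d C X p j R x = (if x j \<in> adm C X 2 j
      then d2 (j \<in> C) (\<lambda>s. ln (if Pa E j = {} then q j s else b j s)) (x j) else 0)"
      unfolding adm_law_eq[OF RV] AE_event[OF R J order_refl]
      using AE_prod_int[OF RV] by eventually_elim (use sink in \<open>auto simp: curv_def D2_log_marg_sink[OF R _ j]\<close>)
  qed
qed

lemma nonlinear_D2_nonzero:
  assumes nl: "nonlinear_glm E C X \<eta>" and j: "j \<in> Pa E i"
  obtains z where "z \<in> prod_int C X (Pa E i)" "z j \<in> adm C X 2 j" "D2 C j (\<eta> i) z \<noteq> 0"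
proof -
  have "(j, i) \<in> E" using j by (simp add: Pa_def)
  then obtain z where z: "z \<in> prod_int C X (Pa E i - {j})"
    and na: "\<nexists>\<alpha> \<beta>. \<forall>t\<in>supp_int C X j. \<eta> i (z(j := t)) = \<alpha> * t + \<beta>"
    using nl unfolding nonlinear_glm_def by blast
  have jV: "j \<in> {1..d}" using parent_in[OF j] by blast
  have zt: "z(j := t) \<in> prod_int C X (Pa E i)" if "t \<in> supp_int C X j" for t
    using z that j by (auto simp: prod_int_def PiE_iff extensional_def)
  obtain t0 where t0: "t0 \<in> supp_int C X j" using supp_int_nonempty[OF jV] by blast
  have sm: "smooth_on (j \<in> C) (supp_int C X j) (\<lambda>t. \<eta> i (z(j := t)))"
    using eta_smooth[OF j zt[OF t0]] by simp
  have ne: "steps (j \<in> C) 1 (supp_int C X j) \<noteq> {}"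
    using adm_nonempty[OF jV, of 1] by (simp add: adm_eq)
  obtain t where t: "t \<in> adm C X 2 j" "d2 (j \<in> C) (\<lambda>t. \<eta> i (z(j := t))) t \<noteq> 0"
    using d2_zero_imp_affine[OF linear_domain_supp_int[OF jV] sm ne] na unfolding adm_eq by blast
  show ?thesis
    using that[of "z(j := t)"] t zt[of t] adm_subset[of 2 j] by (auto simp: D2_eq)
qed

text \<open>Nontriviality compares two possibly distant values of the parent; the contrapositive of
  \<open>d1_zero_imp_const\<close> finds a nonzero local difference between them.\<close>

lemma eta_D1_nonzero:
  assumes j: "j \<in> Pa E i"
  obtains z where "z \<in> prod_int C X (Pa E i)" "z j \<in> adm C X 1 j" "D1 C j (\<eta> i) z \<noteq> 0"
proof -
  have "(j, i) \<in> E" using j by (simp add: Pa_def)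
  then obtain z t where z: "z \<in> prod_int C X (Pa E i)" and t: "t \<in> supp_int C X j"
    and ne: "\<eta> i (z(j := t)) \<noteq> \<eta> i z"
    using eta_nontrivial by blast
  have jV: "j \<in> {1..d}" using parent_in[OF j] by blast
  have zj: "z j \<in> supp_int C X j" using z j by (auto simp: prod_int_def)
  have diff: "(\<lambda>t. \<eta> i (z(j := t))) differentiable at s" if "j \<notin> C" "s \<in> supp_int C X j" for s
    using eta_smooth[OF j z] that by (simp add: smooth_on_def twice_diff_def)
  obtain s where s: "s \<in> adm C X 1 j" "d1 (j \<in> C) (\<lambda>t. \<eta> i (z(j := t))) s \<noteq> 0"
    using d1_zero_imp_const[OF linear_domain_supp_int[OF jV] diff _ t zj] ne unfolding adm_eq by auto
  show ?thesis
    using that[of "z(j := s)"] s prod_int_upd[OF z j, of s] adm_subset[of 1 j] by (auto simp: D1_eq)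
qed

text \<open>The box over the parents of \<open>i\<close> is enlarged by full supports over the
  remaining nodes. Coordinate \<open>i\<close> is left out so that its value can be varied
  afterwards.\<close>

lemma AE_nonzero_point:
  assumes R: "parent_closed R" and ij: "i \<in> R" "j \<in> Pa E i"
    and r: "r \<le> 2" and cont: "continuous_on (slice i z) \<Phi>"
    and z: "z \<in> prod_int C X (Pa E i)" "z j \<in> adm C X r j" "\<Phi> z \<noteq> (0::real)"
    and Q: "AE x in Pi\<^sub>M (R - {i}) nu. Q x"
  obtains x where "x \<in> prod_int C X (R - {i})" "x j \<in> adm C X r j" "\<Phi> (restrict x (Pa E i)) \<noteq> 0" "Q x"
proof -
  have RV: "R - {i} \<subseteq> {1..d}" and PaR: "Pa E i \<subseteq> R - {i}"
    using R ij(1) not_own_parent[of i] by (auto simp: parent_closed_def)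
  obtain A where A: "\<And>l. l \<in> Pa E i \<Longrightarrow> A l \<in> sets (nu l) \<and> emeasure (nu l) (A l) \<noteq> 0 \<and> A l \<subseteq> supp_int C X l"
    and AC: "\<And>l y. l \<in> Pa E i \<Longrightarrow> l \<in> C \<Longrightarrow> y \<in> A l \<Longrightarrow> y = z l"
    and nz: "\<And>y. y \<in> Pi\<^sub>E (Pa E i) A \<Longrightarrow> \<Phi> y \<noteq> 0"
    using nonzero_box[OF cont z(1,3)] by blast
  define B where "B l = (if l \<in> Pa E i then A l else supp_int C X l)" for l
  have "B l \<in> sets (nu l)" "emeasure (nu l) (B l) \<noteq> 0" if "l \<in> R - {i}" for l
    using A[of l] that RV supp_int_sets[of l] emeasure_supp_int[of l] by (auto simp: B_def)
  then obtain x where x: "x \<in> Pi\<^sub>E (R - {i}) B" "Q x"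
    using AE_obtains_in_box[OF RV _ _ Q] by blast
  have B_sub: "B l \<subseteq> supp_int C X l" for l using A by (auto simp: B_def)
  show ?thesis
  proof (rule that[OF _ _ _ x(2)])
    show "x \<in> prod_int C X (R - {i})" using x(1) B_sub by (auto simp: prod_int_def PiE_iff)
    have xA: "x l \<in> A l" if "l \<in> Pa E i" for l
      using PiE_mem[OF x(1), of l] PaR that by (auto simp: B_def)
    from xA[OF ij(2)]
    \<comment> \<open>A count coordinate \<open>j\<close> is pinned to the admissible value
      \<open>z j\<close>; for a continuous one every interior point is admissible.\<close>
    show "x j \<in> adm C X r j"
      using AC[OF ij(2)] A[OF ij(2)] z(2) by (cases "j \<in> C") (auto simp: adm_def supp_int_def)
    have "restrict x (Pa E i) \<in> Pi\<^sub>E (Pa E i) A"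
      using xA by auto
    then show "\<Phi> (restrict x (Pa E i)) \<noteq> 0" by (rule nz)
  qed
qed

lemma AE_split:
  assumes R: "R \<subseteq> {1..d}" and i: "i \<in> R" and Q: "AE x in Pi\<^sub>M R nu. Q x"
  shows "AE x in Pi\<^sub>M (R - {i}) nu. AE y in nu i. Q (x(i := y))"
proof -
  have eq: "insert i (R - {i}) = R" using i by blast
  show ?thesis
    by (rule nu.AE_PiM_insert[of "R - {i}" i Q, unfolded eq, OF _ _ Q]) (use finite_subset[OF R] in simp_all)
qed

lemma prod_int_insert:
  "x \<in> prod_int C X (R - {i}) \<Longrightarrow> i \<in> R \<Longrightarrow> a \<in> supp_int C X i \<Longrightarrow> x(i := a) \<in> prod_int C X R"
  by (auto simp: prod_int_def PiE_iff extensional_def)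

lemma nonsink_S_score:
  assumes R: "parent_closed R" and j: "j \<in> R" and nonsink: "\<not> (\<forall>k\<in>R. j \<notin> Pa E k)"
    and nl: "nonlinear_glm E C X \<eta>"
    and L2: "square_integrable (adm_law C X P j R) (curv d C X p j R)"
  shows "S_score d C X P p j R \<noteq> 0"
proof
  assume zero: "S_score d C X P p j R = 0"
  have RV: "R \<subseteq> {1..d}" using R by (simp add: parent_closed_def)
  have jV: "j \<in> {1..d}" using j RV by blast
  have J: "{j} \<subseteq> R" using j by simp
  let ?T = "{k \<in> R. j \<in> Pa E k}"
  \<comment> \<open>Maximality along edges, from well-foundedness of the reversed relation: no child
    of \<open>i\<close> in \<open>R\<close> is also a child of \<open>j\<close>.\<close>
  obtain i where "i \<in> ?T" and max: "\<And>k. (k, i) \<in> E\<inverse> \<Longrightarrow> k \<notin> ?T"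
    using wfE_min'[OF wf_E_converse, of ?T] nonsink by blast
  then have i: "i \<in> R" "j \<in> Pa E i" by auto
  have ij: "i \<noteq> j" using parent_in[OF i(2)] by blast
  have last: "k \<noteq> j \<and> j \<notin> Pa E k" if "k \<in> R" "i \<in> Pa E k" for k
  proof
    show "j \<notin> Pa E k" using max[of k] that by (auto simp: Pa_def)
    show "k \<noteq> j"
    proof
      assume "k = j"
      then have "(i, j) \<in> E" "(j, i) \<in> E" using that i by (auto simp: Pa_def)
      then have "(i, i) \<in> E\<^sup>+" by (meson trancl.simps)
      then show False using dag by (auto simp: is_dag_def acyclic_def)
    qed
  qed
  interpret prob_space "adm_law C X P j R"
    unfolding adm_law_eq[OF RV] by (rule prob_space_event[OF R J]) simp
  note Y = coordinate_measurable[OF RV j]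
  obtain h where h: "AE x in adm_law C X P j R. curv d C X p j R x = h x"
    and hc: "\<And>x y. x \<in> space (adm_law C X P j R) \<Longrightarrow> y \<in> space (adm_law C X P j R) \<Longrightarrow> x j = y j \<Longrightarrow> h x = h y"
    using cond_variance_eq_0_imp[OF Y L2] zero unfolding S_score_def by blast
  have sp: "space (adm_law C X P j R) = space (Pi\<^sub>M R nu)"
    by (simp add: adm_law_eq[OF RV] space_marg_law[OF RV])
  have "AE x in Pi\<^sub>M R nu. x j \<in> adm C X 2 j \<longrightarrow> curv d C X p j R x = h x"
    using h unfolding adm_law_eq[OF RV] AE_event[OF R J order_refl] by simp
  \<comment> \<open>Splitting off coordinate \<open>i\<close> allows the others to be fixed at a
    point with nonzero slope while almost every value of \<open>x i\<close> remains usable.\<close>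
  note ae = AE_split[OF RV i(1) this]
  obtain z where z: "z \<in> prod_int C X (Pa E i)" "z j \<in> adm C X 2 j" "D2 C j (\<eta> i) z \<noteq> 0"
    using nonlinear_D2_nonzero[OF nl i(2)] .
  obtain x where x: "x \<in> prod_int C X (R - {i})" "x j \<in> adm C X 2 j"
    and nz: "D2 C j (\<eta> i) (restrict x (Pa E i)) \<noteq> 0"
    and aex: "AE y in nu i. (x(i := y)) j \<in> adm C X 2 j \<longrightarrow> curv d C X p j R (x(i := y)) = h (x(i := y))"
    using AE_nonzero_point[OF R i order_refl D_eta_continuous(2)[OF i(2) z(1,2)] z ae] .
  have iV: "i \<in> {1..d}" using i RV by blast
  obtain a a' where a: "a \<in> supp_int C X i" "a' \<in> supp_int C X i" "a \<noteq> a'"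
    and eq: "curv d C X p j R (x(i := a)) = h (x(i := a))" "curv d C X p j R (x(i := a')) = h (x(i := a'))"
    using AE_nu_two[OF iV aex] x(2) ij by auto
  have pa: "x(i := a) \<in> prod_int C X R" "x(i := a') \<in> prod_int C X R"
    using prod_int_insert[OF x(1) i(1)] a by auto
  \<comment> \<open>Both points have the same coordinate \<open>j\<close>, so \<open>h\<close>
    cannot distinguish them although \<open>x i\<close> differs.\<close>
  have "h (x(i := a)) = h (x(i := a'))"
    using pa prod_int_space[OF RV] ij by (intro hc) (auto simp: sp)
  with eq have "D2 C j (log_marg R) (x(i := a)) = D2 C j (log_marg R) (x(i := a'))"
    using pa x(2) ij by (simp add: curv_def)
  \<comment> \<open>The difference formula needs a base point over all of \<open>R\<close>, whereas
    \<open>x\<close> lives on \<open>R - {i}\<close>; hence \<open>x(i := a)\<close> with coordinate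
    \<open>i\<close> overwritten again.\<close>
  moreover have "D2 C j (log_marg R) (x(i := a, i := a)) = D2 C j (log_marg R) (x(i := a, i := a'))
      + (if j \<in> Pa E i then (a - a') * D2 C j (\<eta> i) (restrict (x(i := a)) (Pa E i)) else 0)"
    using x(2) ij by (intro D2_log_marg_difference[OF R pa(1) i(1) j ij last a(1,2)]) auto
  moreover have "restrict (x(i := a)) (Pa E i) = restrict x (Pa E i)"
    using not_own_parent by (auto simp: restrict_def)
  ultimately show False using nz a(3) i(2) by simp
qed

lemma OCS_pos_iff:
  assumes \<pi>: "causal_order d E \<pi>" and L1: "mixed_curv_L1 d C X P p \<pi>"
    and i: "i \<in> {1..d}" and j: "j \<in> Pred d \<pi> i"
  shows "j \<in> Pa E i \<longleftrightarrow> OCS d C X P p \<pi> j i > 0"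
proof -
  define R where "R = insert i (Pred d \<pi> i)"
  have lt: "\<pi> k < \<pi> l" if "k \<in> Pa E l" for k l using \<pi> that by (auto simp: causal_order_def Pa_def)
  have R: "parent_closed R"
    using lt Pa_subset i by (force simp: parent_closed_def R_def Pred_def)
  have iR: "i \<in> R" and jR: "j \<in> R" and ij: "i \<noteq> j" using j by (auto simp: R_def Pred_def)
  \<comment> \<open>Every node of \<open>R\<close> has order at most that of \<open>i\<close>, so
    \<open>i\<close> has no child there and only its own factor couples it with
    \<open>j\<close>.\<close>
  have last: "i \<notin> Pa E k" if "k \<in> R" for k using lt[of i k] that by (auto simp: R_def Pred_def)
  have RV: "R \<subseteq> {1..d}" using R by (simp add: parent_closed_def)
  have J: "{i, j} \<subseteq> R" using iR jR by simp
  let ?M = "mixed_adm_law C X P i j R" and ?H = "mixed_curv d C X p i j R"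
  have H_eq: "?H x = (if j \<in> Pa E i then D1 C j (\<eta> i) (restrict x (Pa E i)) else 0)"
    if "x \<in> prod_int C X R" "x i \<in> adm C X 1 i" "x j \<in> adm C X 1 j" for x
    using D1_D1_log_marg[OF R that(1) iR jR ij last that(2,3)] that by (simp add: mixed_curv_def)
  have OCS: "OCS d C X P p \<pi> j i = (\<integral>x. \<bar>?H x\<bar> \<partial>?M)" by (simp add: OCS_def R_def Let_def)
  have H_int: "integrable ?M ?H" using L1 i j by (simp add: mixed_curv_L1_def R_def Let_def)
  \<comment> \<open>The moment condition makes the vanishing of the integral of the absolute value
    equivalent to vanishing almost surely.\<close>
  have zero_iff: "OCS d C X P p \<pi> j i = 0 \<longleftrightarrow>
      (AE x in Pi\<^sub>M R nu. x i \<in> adm C X 1 i \<and> x j \<in> adm C X 1 j \<longrightarrow> ?H x = 0)"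
  proof -
    have "OCS d C X P p \<pi> j i = 0 \<longleftrightarrow> (AE x in ?M. \<bar>?H x\<bar> = 0)"
      unfolding OCS by (rule integral_nonneg_eq_0_iff_AE) (use H_int in auto)
    also have "\<dots> \<longleftrightarrow> (AE x in Pi\<^sub>M R nu. x i \<in> adm C X 1 i \<and> x j \<in> adm C X 1 j \<longrightarrow> ?H x = 0)"
      unfolding mixed_adm_law_eq[OF RV] by (subst AE_event[OF R J]) auto
    finally show ?thesis .
  qed
  have nonneg: "0 \<le> OCS d C X P p \<pi> j i" by (simp add: OCS)
  show ?thesis
  proof (cases "j \<in> Pa E i")
    case False
    have "AE x in Pi\<^sub>M R nu. x i \<in> adm C X 1 i \<and> x j \<in> adm C X 1 j \<longrightarrow> ?H x = 0"
      using AE_prod_int[OF RV] by eventually_elim (simp add: H_eq False)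
    with False zero_iff show ?thesis by simp
  next
    case True
    have "OCS d C X P p \<pi> j i \<noteq> 0"
    proof
      assume "OCS d C X P p \<pi> j i = 0"
      then have ae: "AE x in Pi\<^sub>M R nu. x i \<in> adm C X 1 i \<and> x j \<in> adm C X 1 j \<longrightarrow> ?H x = 0"
        using zero_iff by blast
      obtain z where z: "z \<in> prod_int C X (Pa E i)" "z j \<in> adm C X 1 j" "D1 C j (\<eta> i) z \<noteq> 0"
        using eta_D1_nonzero[OF True] .
      obtain x where x: "x \<in> prod_int C X (R - {i})" "x j \<in> adm C X 1 j"
        and nz: "D1 C j (\<eta> i) (restrict x (Pa E i)) \<noteq> 0"
        and aex: "AE y in nu i. (x(i := y)) i \<in> adm C X 1 i \<and> (x(i := y)) j \<in> adm C X 1 j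
          \<longrightarrow> ?H (x(i := y)) = 0"
        using AE_nonzero_point[OF R iR True one_le_numeral D_eta_continuous(1)[OF True z(1,2)] z AE_split[OF RV iR ae]] .
      \<comment> \<open>Almost every value of \<open>x i\<close> gives zero curvature where
        admissible, and the admissible values have positive measure; one such value suffices, as the
        curvature does not depend on it.\<close>
      obtain a where a: "a \<in> adm C X 1 i" "?H (x(i := a)) = 0"
      proof (rule ccontr)
        assume "\<not> thesis"
        then have "AE y in nu i. y \<notin> adm C X 1 i"
          using aex x(2) ij that by (auto elim!: eventually_mono)
        then show False
          using AE_iff_null_sets[OF adm_sets[OF i]] emeasure_adm[OF i, of 1] by auto
      qed
      have xa: "x(i := a) \<in> prod_int C X R"
        using prod_int_insert[OF x(1) iR] a(1) adm_subset by blast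
      have "restrict (x(i := a)) (Pa E i) = restrict x (Pa E i)"
        using not_own_parent by (auto simp: restrict_def)
      then show False using H_eq[OF xa] a x(2) ij nz True by simp
    qed
    with nonneg True show ?thesis by simp
  qed
qed

end

theorem theorem8:
  fixes d :: nat
    and E :: "(nat \<times> nat) set"
    and C :: "nat set"
    and X :: "nat \<Rightarrow> real set"
    and P :: "(nat \<Rightarrow> real) measure"
    and p :: "(nat \<Rightarrow> real) \<Rightarrow> real"
    and q b :: "nat \<Rightarrow> real \<Rightarrow> real"
    and \<eta> :: "nat \<Rightarrow> (nat \<Rightarrow> real) \<Rightarrow> real"
  assumes "regular_glm_dag d E C X P p q b \<eta>"
  shows
    "(nonlinear_glm E C X \<eta> \<and> curv_L2 d E C X P p \<longrightarrow>
       (\<forall>R j. ancestral d E R \<and> R \<noteq> {} \<and> j \<in> R \<longrightarrow>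
          (is_sink E R j \<longleftrightarrow> S_score d C X P p j R = 0)))
     \<and> (\<forall>\<pi>. causal_order d E \<pi> \<and> mixed_curv_L1 d C X P p \<pi> \<longrightarrow>
          (\<forall>i\<in>{1..d}. \<forall>j\<in>Pred d \<pi> i. j \<in> Pa E i \<longleftrightarrow> OCS d C X P p \<pi> j i > 0))"
proof -
  interpret regular_glm_dag d E C X P p q b \<eta> by (rule assms)
  have "is_sink E R j \<longleftrightarrow> S_score d C X P p j R = 0"
    if "nonlinear_glm E C X \<eta>" "curv_L2 d E C X P p" "ancestral d E R" "R \<noteq> {}" "j \<in> R" for R j
  proof -
    have "square_integrable (adm_law C X P j R) (curv d C X p j R)"
      using that by (auto simp: curv_L2_def)
    then show ?thesis
      unfolding is_sink_iff[OF that(5)]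
      using sink_S_score[OF ancestral_parent_closed[OF that(3)] that(5)]
        nonsink_S_score[OF ancestral_parent_closed[OF that(3)] that(5) _ that(1)] by blast
  qed
  moreover have "j \<in> Pa E i \<longleftrightarrow> OCS d C X P p \<pi> j i > 0"
    if "causal_order d E \<pi>" "mixed_curv_L1 d C X P p \<pi>" "i \<in> {1..d}" "j \<in> Pred d \<pi> i" for \<pi> i j
    by (rule OCS_pos_iff[OF that])
  ultimately show ?thesis by (intro conjI allI impI ballI; elim conjE) metis+
qed

end
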